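(* Let $d\ge2$. There exist constants $0<c<C$ depending only on $d$ such that the following holds for every threshold $m>1$ and all sufficiently large $n$. Consider the sandpile with initial distribution $n\delta_0$ and threshold $m$. Let $x_0\in\partial V_{n,m}$ and let $r>0$ be such that $B(x_0,r)\cap V_{n,0}=\emptyset$ and $B(x_0,r+1)\cap V_{n,0}\ne\emptyset$. Then $$c\,\frac{n^{1/d}}{m}\le r\le C\,\frac{n^{1/d}}{m}.$$
   Context: For $x,y\in\mathbb{Z}^d$ write $x\sim y$ if $\|x-y\|_{\ell^1}=1$. $B(x,r)$ is the Euclidean ball $\{y:|y-x|<r\}$. The sandpile. Start with mass $n$ at the origin of $\mathbb{Z}^d$ and no mass elsewhere, odometer identically $0$, and visited set $\{0\}$; $m$ is the threshold. At time $k$, with current odometer $u_k$ and mass distribution $\mu_k$, a site $x$ is unstable if either (a) $\mu_k(x)>m$, or (b) $0<\mu_k(x)\le m$ and $u_k(x)>\frac1m n^{2/d}$. The excess is $\mathcal{E}(x)=\mu_k(x)-m$ in case (a) and $\mathcal{E}(x)=\mu_k(x)$ in case (b). Toppling an unstable site $x$ removes mass $\mathcal{E}(x)$ from $x$, gives $\frac{1}{2d}\mathcal{E}(x)$ to each of its $2d$ neighbours (which are then added to the visited set), and increases the odometer at $x$ by $\mathcal{E}(x)$; toppling a stable site does nothing. Toppling along any infinitive sequence (one in which every $x\in\mathbb{Z}^d$ appears infinitely often), odometers and masses converge pointwise to finite limits which have no unstable site and do not depend on the sequence; the limit odometer $u$ is the odometer of the sandpile. $V_{n,m}\subset\mathbb{Z}^d$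 is the set of all sites ever visited, $V_{n,0}=\{x: u(x)>\frac1m n^{2/d}\}$, and $V_{n,1}=V_{n,m}\setminus V_{n,0}$. The boundary $\partial V_{n,m}$ is the set of $x\in V_{n,m}$ having a neighbour $y\sim x$ with $y\notin V_{n,m}$. *)

theory Defs
  imports "HOL-Analysis.Analysis"
begin

text \<open>The lattice \<open>\<int>\<^sup>d\<close> is the type \<^typ>\<open>int ^ 'd\<close> with \<open>d = CARD('d)\<close>.  As \<^typ>\<open>int\<close> is not a
  metric space in the library, Euclidean distances are measured in \<^typ>\<open>real ^ 'd\<close>.\<close>

definition to_real :: "int ^ 'd \<Rightarrow> real ^ 'd"
  where "to_real x = (\<chi> i. real_of_int (x $ i))"

definition lattice_ball :: "int ^ 'd::finite \<Rightarrow> real \<Rightarrow> (int ^ 'd) set"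
  where "lattice_ball x r = {y. to_real y \<in> ball (to_real x) r}"

definition adj :: "int ^ 'd \<Rightarrow> int ^ 'd \<Rightarrow> bool"  (infix "\<sim>" 50)
  where "x \<sim> y \<longleftrightarrow> (\<Sum>i\<in>UNIV. \<bar>x $ i - y $ i\<bar>) = 1"

record 'd sandpile =
  mass :: "int ^ 'd \<Rightarrow> real"
  odometer :: "int ^ 'd \<Rightarrow> real"
  visited :: "(int ^ 'd) set"

definition initial :: "real \<Rightarrow> 'd::finite sandpile"
  where "initial n = \<lparr>mass = (\<lambda>x. if x = 0 then n else 0), odometer = (\<lambda>x. 0), visited = {0}\<rparr>"

definition odometer_bound :: "'d::finite itself \<Rightarrow> real \<Rightarrow> real \<Rightarrow> real"
  where "odometer_bound _ n m = (1 / m) * n powr (2 / real CARD('d))"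

definition unstable :: "real \<Rightarrow> real \<Rightarrow> 'd::finite sandpile \<Rightarrow> int ^ 'd \<Rightarrow> bool"
  where "unstable n m S x \<longleftrightarrow>
    mass S x > m \<or>
    (0 < mass S x \<and> mass S x \<le> m \<and> odometer S x > odometer_bound TYPE('d) n m)"

text \<open>Only meaningful at unstable sites.\<close>

definition excess :: "real \<Rightarrow> 'd::finite sandpile \<Rightarrow> int ^ 'd \<Rightarrow> real"
  where "excess m S x = (if mass S x > m then mass S x - m else mass S x)"

definition topple :: "real \<Rightarrow> real \<Rightarrow> int ^ 'd \<Rightarrow> 'd::finite sandpile \<Rightarrow> 'd sandpile"
  where "topple n m x S =
    (if unstable n m S x then
       \<lparr>mass = (\<lambda>y. if y = x then mass S x - excess m S x
                    else if x \<sim> y then mass S y + 1 / (2 * real CARD('d)) * excess m S x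
                    else mass S y),
        odometer = (odometer S)(x := odometer S x + excess m S x),
        visited = visited S \<union> {y. x \<sim> y}\<rparr>
     else S)"

primrec sandpile_at :: "real \<Rightarrow> real \<Rightarrow> (nat \<Rightarrow> int ^ 'd) \<Rightarrow> nat \<Rightarrow> 'd::finite sandpile"
  where
    "sandpile_at n m T 0 = initial n"
  | "sandpile_at n m T (Suc k) = topple n m (T k) (sandpile_at n m T k)"

definition infinitive :: "(nat \<Rightarrow> int ^ 'd) \<Rightarrow> bool"
  where "infinitive T \<longleftrightarrow> (\<forall>x. infinite {k. T k = x})"

text \<open>The limit odometer and the sets below do not depend on the infinitive sequence \<open>T\<close>.  Instead
  of selecting one such sequence, \<open>T\<close> is kept as a parameter.\<close>

definition limit_odometer :: "real \<Rightarrow> real \<Rightarrow> (nat \<Rightarrow> int ^ 'd::finite) \<Rightarrow> int ^ 'd \<Rightarrow> real"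
  where "limit_odometer n m T x = lim (\<lambda>k. odometer (sandpile_at n m T k) x)"

definition V :: "real \<Rightarrow> real \<Rightarrow> (nat \<Rightarrow> int ^ 'd::finite) \<Rightarrow> (int ^ 'd) set"
  where "V n m T = (\<Union>k. visited (sandpile_at n m T k))"

definition V0 :: "real \<Rightarrow> real \<Rightarrow> (nat \<Rightarrow> int ^ 'd::finite) \<Rightarrow> (int ^ 'd) set"
  where "V0 n m T = {x. limit_odometer n m T x > odometer_bound TYPE('d) n m}"

definition lattice_boundary :: "(int ^ 'd) set \<Rightarrow> (int ^ 'd) set"
  where "lattice_boundary A = {x \<in> A. \<exists>y. y \<sim> x \<and> y \<notin> A}"

end

theory Submission imports Defs begin

text \<open>On the set where it does not exceed the threshold \<open>K = n\<^sup>2\<^sup>/\<^sup>d / m\<close>, the limit odometer \<open>v\<close> has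
  Laplacian \<open>m\<close> as long as it is positive; everywhere \<open>\<Delta>v + n \<delta>\<^sub>0\<close>, the limit mass, lies in \<open>[0, m]\<close>.
  The limit mass at sites with \<open>v > K\<close> may depend on the toppling sequence, but nothing more about it
  is needed. The upper bound on \<open>r\<close> is the quadratic growth of \<open>v\<close> away from its zero set. The lower bound
  is the opposite estimate: since \<open>v\<close> vanishes at \<open>x\<^sub>0\<close>, the weak Harnack inequality bounds its mean
  over balls around \<open>x\<^sub>0\<close>, and the sub-mean value property turns this into \<open>v \<le> C m r\<^sup>2\<close> at distance
  \<open>r\<close>. The same Harnack inequality shows that \<open>x\<^sub>0\<close> cannot be too close to the source.\<close>

section \<open>The discrete Laplacian\<close>

text \<open>With \<open>s = n powr (1 / d) / m\<close> the threshold is \<open>K = m * s^2\<close>,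
  and both estimates compare it with \<open>m * r^2\<close>; this is why \<open>r\<close> is of
  order \<open>s\<close> with constants depending on the dimension only. Taking \<open>n\<close>
  large makes \<open>s\<close> exceed a constant, which absorbs the lattice shifts in the radii. The
  potential theory rests on one explicit test function at each scale \<sigma>: nonnegative,
  compactly supported, subharmonic except at one site, with Laplacian at least of order
  \<open>1 / \<sigma>^d\<close> on a ball. Summation by parts against it gives the weak Harnack
  inequality, from which the sub-mean value property follows. Before any of this applies to
  \<open>v\<close>, convergence has to be shown, since \<open>v\<close> is defined by
  \<open>lim\<close>: conservation of mass confines the toppled sites uniformly in time, and the
  second moment of the mass then bounds the odometer.\<close>

definition lap :: "(int ^ 'd::finite \<Rightarrow> real) \<Rightarrow> int ^ 'd \<Rightarrow> real" where
  "lap f x = (\<Sum>i\<in>UNIV. f (x + axis i 1) + f (x - axis i 1)) / (2 * real CARD('d)) - f x"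

definition sqn :: "int ^ 'd::finite \<Rightarrow> real" where
  "sqn x = (\<Sum>i\<in>UNIV. (real_of_int (x $ i))\<^sup>2)"

definition len :: "int ^ 'd::finite \<Rightarrow> real" where
  "len x = norm (to_real x)"

lemma len_sq: "(len x)\<^sup>2 = sqn x"
  by (simp add: len_def sqn_def to_real_def norm_vec_def L2_set_def sum_nonneg)

lemma sqn_nonneg: "sqn x \<ge> 0"
  by (simp add: sqn_def sum_nonneg)

lemma len_nonneg: "len x \<ge> 0"
  by (simp add: len_def)

lemma to_real_add: "to_real (x + y) = to_real x + to_real y"
  and to_real_diff: "to_real (x - y) = to_real x - to_real y"
  by (simp_all add: to_real_def vec_eq_iff)

lemma len_triangle: "len (x + y) \<le> len x + len y"
  by (simp add: len_def to_real_add norm_triangle_ineq)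

lemma len_minus_commute: "len (x - y) = len (y - x)"
  by (simp add: len_def to_real_diff norm_minus_commute)

lemma len_minus: "len (- x) = len x"
  using len_minus_commute[of 0 x] by simp

lemma len_diff_triangle: "len (x - z) \<le> len (x - y) + len (y - z)"
  using len_triangle[of "x - y" "y - z"] by simp

lemma to_real_axis: "to_real (axis i 1) = axis i 1"
  by (simp add: to_real_def axis_def vec_eq_iff)

lemma len_axis: "len (axis i 1) = 1"
  by (simp add: len_def to_real_axis)

lemma len_0: "len 0 = 0"
  by (simp add: len_def to_real_def vec_eq_iff)

lemma mem_lattice_ball: "y \<in> lattice_ball x r \<longleftrightarrow> len (y - x) < r"
  by (simp add: lattice_ball_def len_def to_real_diff dist_norm norm_minus_commute)

lemma coord_le_len: "\<bar>real_of_int (x $ i)\<bar> \<le> len x"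
  using component_le_norm_cart[of "to_real x" i] by (simp add: len_def to_real_def)

lemma sqn_add_axis: "sqn (x + axis i 1) = sqn x + 2 * real_of_int (x $ i) + 1"
  and sqn_diff_axis: "sqn (x - axis i 1) = sqn x - 2 * real_of_int (x $ i) + 1"
proof -
  have "sqn (x + axis i 1) - sqn x = (\<Sum>j\<in>UNIV. if j = i then 2 * real_of_int (x $ i) + 1 else 0)"
    unfolding sqn_def sum_subtractf[symmetric]
    by (intro sum.cong) (auto simp: axis_def power2_eq_square algebra_simps)
  then show "sqn (x + axis i 1) = sqn x + 2 * real_of_int (x $ i) + 1" by simp
  have "sqn (x - axis i 1) - sqn x = (\<Sum>j\<in>UNIV. if j = i then - 2 * real_of_int (x $ i) + 1 else 0)"
    unfolding sqn_def sum_subtractf[symmetric]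
    by (intro sum.cong) (auto simp: axis_def power2_eq_square algebra_simps)
  then show "sqn (x - axis i 1) = sqn x - 2 * real_of_int (x $ i) + 1" by simp
qed

text \<open>The averaging normalisation of \<open>lap\<close> is that of a toppling; with it the
  paraboloid has constant Laplacian on the lattice, without discretisation error. It is the
  comparison function in both radius bounds and the weight of the second moment.\<close>

lemma lap_sqn: "lap sqn x = 1"
  by (simp add: lap_def sqn_add_axis sqn_diff_axis sum.distrib field_simps)

lemma lap_add: "lap (\<lambda>x. f x + g x) x = lap f x + lap g x"
  and lap_diff: "lap (\<lambda>x. f x - g x) x = lap f x - lap g x"
  and lap_cmult: "lap (\<lambda>x. c * f x) x = c * lap f x"
proof -
  show "lap (\<lambda>x. f x + g x) x = lap f x + lap g x"
    by (simp add: lap_def sum.distrib add_divide_distrib)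
  show "lap (\<lambda>x. f x - g x) x = lap f x - lap g x"
    by (simp add: lap_def sum.distrib sum_subtractf diff_divide_distrib add_divide_distrib)
  show "lap (\<lambda>x. c * f x) x = c * lap f x"
    by (simp add: lap_def sum.distrib sum_distrib_left right_diff_distrib distrib_left)
qed

lemma lap_const: "lap (\<lambda>x. c) x = 0"
  by (simp add: lap_def)

lemma lap_shift: "lap (\<lambda>x. f (x - y)) x = lap f (x - y)"
  by (simp add: lap_def algebra_simps)

lemma lap_mono:
  assumes "f x = g x" "\<And>i. f (x + axis i 1) \<le> g (x + axis i 1)" "\<And>i. f (x - axis i 1) \<le> g (x - axis i 1)"
  shows "lap f x \<le> lap g x"
  using assms by (auto simp: lap_def intro!: divide_right_mono sum_mono add_mono)

lemma lap_ge_neg: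
  assumes "\<And>i. f (x + axis i 1) \<ge> 0" "\<And>i. f (x - axis i 1) \<ge> 0"
  shows "lap f x \<ge> - f x"
  using assms by (auto simp: lap_def intro!: divide_nonneg_nonneg sum_nonneg add_nonneg_nonneg)

lemma lap_ge_single:
  assumes "\<And>i. f (x + axis i 1) \<ge> 0" "\<And>i. f (x - axis i 1) \<ge> 0"
    and "y = x + axis j 1 \<or> y = x - axis j 1"
  shows "lap f x \<ge> f y / (2 * real CARD('d)) - f (x :: int ^ 'd::finite)"
proof -
  have "f y \<le> f (x + axis j 1) + f (x - axis j 1)"
    using assms by (metis add.commute le_add_same_cancel1)
  also have "\<dots> \<le> (\<Sum>i\<in>UNIV. f (x + axis i 1) + f (x - axis i 1))"
    by (rule member_le_sum) (auto intro: add_nonneg_nonneg assms)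
  finally show ?thesis by (simp add: lap_def divide_right_mono)
qed

lemma ex_larger_neighbour:
  assumes "lap f x > 0"
  obtains i y where "y = x + axis i 1 \<or> y = x - axis i 1" "f y > f (x :: int ^ 'd::finite)"
proof -
  have "\<exists>i. f (x + axis i 1) > f x \<or> f (x - axis i 1) > f x"
  proof (rule ccontr)
    assume "\<not> ?thesis"
    then have "(\<Sum>i\<in>UNIV. f (x + axis i 1) + f (x - axis i 1)) \<le> (\<Sum>i\<in>(UNIV :: 'd set). 2 * f x)"
      by (intro sum_mono) (smt (verit))
    then have "(\<Sum>i\<in>UNIV. f (x + axis i 1) + f (x - axis i 1)) / (2 * real CARD('d)) \<le> f x"
      by (simp add: field_simps)
    with assms show False by (simp add: lap_def)
  qed
  then show ?thesis using that by blast
qed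

section \<open>Finite balls and summation by parts\<close>

lemma finite_coord_bounded: "finite {x :: int ^ 'd::finite. \<forall>i. \<bar>x $ i\<bar> \<le> M}"
proof -
  have "finite ((\<lambda>f. \<chi> i. f i) ` (UNIV \<rightarrow>\<^sub>E {-M..M} :: ('d \<Rightarrow> int) set))"
    by (intro finite_imageI finite_PiE) auto
  moreover have "{x :: int ^ 'd. \<forall>i. \<bar>x $ i\<bar> \<le> M} \<subseteq> (\<lambda>f. \<chi> i. f i) ` (UNIV \<rightarrow>\<^sub>E {-M..M})"
  proof
    fix x :: "int ^ 'd" assume "x \<in> {x. \<forall>i. \<bar>x $ i\<bar> \<le> M}"
    then have "($) x \<in> UNIV \<rightarrow>\<^sub>E {-M..M}" by (auto simp: abs_le_iff minus_le_iff)
    moreover have "x = (\<chi> i. x $ i)" by simp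
    ultimately show "x \<in> (\<lambda>f. \<chi> i. f i) ` (UNIV \<rightarrow>\<^sub>E {-M..M})" by blast
  qed
  ultimately show ?thesis by (rule finite_subset[rotated])
qed

lemma finite_len_le: "finite {x :: int ^ 'd::finite. len (x - y) \<le> R}"
proof -
  have "{x :: int ^ 'd. len x \<le> R} \<subseteq> {x. \<forall>i. \<bar>x $ i\<bar> \<le> \<lceil>R\<rceil>}"
  proof clarify
    fix x :: "int ^ 'd" and i assume "len x \<le> R"
    with coord_le_len[of x i] show "\<bar>x $ i\<bar> \<le> \<lceil>R\<rceil>" by linarith
  qed
  then have "finite {x :: int ^ 'd. len x \<le> R}"
    using finite_coord_bounded finite_subset by blast
  then have "finite ((\<lambda>x. x + y) ` {x. len x \<le> R})" by simp
  moreover have "{x. len (x - y) \<le> R} \<subseteq> (\<lambda>x. x + y) ` {x. len x \<le> R}"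
    by (auto intro!: image_eqI[where x = "_ - y"])
  ultimately show ?thesis by (rule finite_subset[rotated])
qed

lemma finite_len_less: "finite {x :: int ^ 'd::finite. len (x - y) < R}"
  by (rule finite_subset[OF _ finite_len_le[of y R]]) auto

lemma sum_mult_shift:
  fixes f g :: "int ^ 'd::finite \<Rightarrow> real"
  assumes "finite A" "\<And>x. g x \<noteq> 0 \<Longrightarrow> x \<in> A \<and> x - e \<in> A"
  shows "(\<Sum>x\<in>A. f x * g (x + e)) = (\<Sum>x\<in>A. f (x - e) * g x)"
proof -
  let ?G = "{x. g x \<noteq> 0}"
  have "(\<Sum>x\<in>A. f x * g (x + e)) = (\<Sum>x\<in>(\<lambda>x. x - e) ` ?G. f x * g (x + e))"
    using assms by (intro sum.mono_neutral_right) (auto intro!: image_eqI[where x = "_ + e"])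
  also have "\<dots> = (\<Sum>x\<in>?G. f (x - e) * g x)"
    by (subst sum.reindex) (auto simp: inj_on_def)
  also have "\<dots> = (\<Sum>x\<in>A. f (x - e) * g x)"
    using assms by (intro sum.mono_neutral_left) auto
  finally show ?thesis .
qed

text \<open>\<open>A\<close> contains the support of \<open>g\<close> together with all its
  neighbours, so the shifted sums lose nothing at the edge and there are no boundary terms.\<close>

lemma sum_by_parts:
  fixes f g :: "int ^ 'd::finite \<Rightarrow> real"
  assumes A: "finite A"
    and g: "\<And>x. g x \<noteq> 0 \<Longrightarrow> x \<in> A \<and> (\<forall>i. x + axis i 1 \<in> A \<and> x - axis i 1 \<in> A)"
  shows "(\<Sum>x\<in>A. f x * lap g x) = (\<Sum>x\<in>A. g x * lap f x)"
proof -
  have 1: "(\<Sum>x\<in>A. f x * g (x + axis i 1)) = (\<Sum>x\<in>A. f (x - axis i 1) * g x)" for i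
    by (rule sum_mult_shift) (use A g in auto)
  have 2: "(\<Sum>x\<in>A. f x * g (x - axis i 1)) = (\<Sum>x\<in>A. f (x + axis i 1) * g x)" for i
    using sum_mult_shift[of A g "- axis i 1" f] A g by auto
  have "(\<Sum>x\<in>A. f x * (\<Sum>i\<in>UNIV. g (x + axis i 1) + g (x - axis i 1)))
      = (\<Sum>i\<in>UNIV. (\<Sum>x\<in>A. f x * g (x + axis i 1)) + (\<Sum>x\<in>A. f x * g (x - axis i 1)))"
    unfolding sum_distrib_left by (subst sum.swap) (simp add: sum.distrib distrib_left)
  also have "\<dots> = (\<Sum>i\<in>UNIV. (\<Sum>x\<in>A. f (x - axis i 1) * g x) + (\<Sum>x\<in>A. f (x + axis i 1) * g x))"
    by (simp only: 1 2)
  also have "\<dots> = (\<Sum>x\<in>A. g x * (\<Sum>i\<in>UNIV. f (x + axis i 1) + f (x - axis i 1)))"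
    unfolding sum_distrib_left sum.distrib[symmetric]
    by (subst sum.swap) (simp add: distrib_left mult.commute add.commute)
  finally have "(\<Sum>x\<in>A. f x * (\<Sum>i\<in>UNIV. g (x + axis i 1) + g (x - axis i 1)))
    = (\<Sum>x\<in>A. g x * (\<Sum>i\<in>UNIV. f (x + axis i 1) + f (x - axis i 1)))" .
  moreover have "(\<Sum>x\<in>A. f x * lap g x) = (\<Sum>x\<in>A. f x * (\<Sum>i\<in>UNIV. g (x + axis i 1) + g (x - axis i 1)))
      / (2 * real CARD('d)) - (\<Sum>x\<in>A. f x * g x)" for f g :: "int ^ 'd \<Rightarrow> real"
    by (simp add: lap_def sum_subtractf right_diff_distrib
        sum_divide_distrib[of _ A])
  ultimately show ?thesis by (simp add: mult.commute)
qed

lemma adj_iff: "x \<sim> y \<longleftrightarrow> (\<exists>i. y = x + axis i 1 \<or> y = x - axis i 1)"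
proof
  assume "x \<sim> y"
  then have s: "(\<Sum>i\<in>UNIV. \<bar>x $ i - y $ i\<bar>) = 1" by (simp add: adj_def)
  then obtain i where i: "x $ i \<noteq> y $ i" by (metis (mono_tags, lifting) abs_zero diff_self sum.neutral zero_neq_one)
  have s2: "(\<Sum>j\<in>UNIV. \<bar>x $ j - y $ j\<bar>) = \<bar>x $ i - y $ i\<bar> + (\<Sum>j\<in>UNIV - {i}. \<bar>x $ j - y $ j\<bar>)"
    by (rule sum.remove) auto
  have nn: "(\<Sum>j\<in>UNIV - {i}. \<bar>x $ j - y $ j\<bar>) \<ge> 0" by (rule sum_nonneg) auto
  have "\<bar>x $ i - y $ i\<bar> \<ge> 1" using i by linarith
  with s s2 nn have 1: "\<bar>x $ i - y $ i\<bar> = 1" and 0: "(\<Sum>j\<in>UNIV - {i}. \<bar>x $ j - y $ j\<bar>) = 0" by linarith+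
  from 0 have eq: "x $ j = y $ j" if "j \<noteq> i" for j
    using that by (subst (asm) sum_nonneg_eq_0_iff) auto
  from 1 have "y $ i = x $ i + 1 \<or> y $ i = x $ i - 1" by linarith
  then have "y = x + axis i 1 \<or> y = x - axis i 1"
    using eq by (auto simp: vec_eq_iff axis_def)
  then show "\<exists>i. y = x + axis i 1 \<or> y = x - axis i 1" by blast
next
  assume "\<exists>i. y = x + axis i 1 \<or> y = x - axis i 1"
  then obtain i where "y = x + axis i 1 \<or> y = x - axis i 1" by blast
  then have "(\<Sum>j\<in>UNIV. \<bar>x $ j - y $ j\<bar>) = (\<Sum>j\<in>UNIV. if j = i then 1 else 0)"
    by (intro sum.cong) (auto simp: axis_def)
  then show "x \<sim> y" by (simp add: adj_def)
qed

lemma adj_sym: "x \<sim> y \<longleftrightarrow> y \<sim> x"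
  by (simp add: adj_def abs_minus_commute)

lemma adj_len: "x \<sim> y \<Longrightarrow> len (y - x) = 1"
  by (auto simp: adj_iff len_axis len_minus)

section \<open>The weak Harnack inequality\<close>

text \<open>Midpoint convexity of a negative power: AM-GM for the square roots of the two terms,
  together with \<open>(S - b) * (S + b) \<le> S * S\<close>.\<close>

lemma powr_midpoint:
  fixes a b S :: real
  assumes "0 \<le> b" "b < S" "a \<ge> 0"
  shows "2 * S powr (-a) \<le> (S - b) powr (-a) + (S + b) powr (-a)"
proof -
  let ?x = "(S - b) powr (-a/2)" and ?y = "(S + b) powr (-a/2)"
  have xy: "(S - b) powr (-a) = ?x\<^sup>2" "(S + b) powr (-a) = ?y\<^sup>2"
    by (simp_all add: power2_eq_square flip: powr_add)
  have "?x * ?y = ((S - b) * (S + b)) powr (-a/2)"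
    using assms by (simp add: powr_mult)
  moreover have "((S - b) * (S + b)) powr (-a/2) \<ge> (S * S) powr (-a/2)"
    using assms mult_pos_pos[of "S - b" "S + b"]
    by (intro powr_mono2') (auto simp: algebra_simps)
  moreover have "(S * S) powr (-a/2) = S powr (-a)"
    using assms by (simp add: powr_mult flip: powr_add)
  moreover have "2 * (?x * ?y) \<le> ?x\<^sup>2 + ?y\<^sup>2"
    using sum_squares_bound[of ?x ?y] by simp
  ultimately show ?thesis using xy by linarith
qed

lemma powr_diff_ge:
  fixes p b S :: real
  assumes "0 \<le> b" "b < S" "p \<ge> 0"
  shows "2 * b * p * S powr (-p-1) \<le> (S - b) powr (-p) - (S + b) powr (-p)"
proof -
  let ?G = "\<lambda>b. (S - b) powr (-p) - (S + b) powr (-p) - 2 * b * p * S powr (-p-1)"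
  have "?G 0 \<le> ?G b"
  proof (rule DERIV_nonneg_imp_nondecreasing[OF assms(1)])
    fix x assume x: "0 \<le> x" "x \<le> b"
    have "(?G has_real_derivative p * ((S - x) powr (-p-1) + (S + x) powr (-p-1) - 2 * S powr (-p-1))) (at x)"
      using x assms by (auto intro!: derivative_eq_intros simp: algebra_simps)
    moreover have "p * ((S - x) powr (-p-1) + (S + x) powr (-p-1) - 2 * S powr (-p-1)) \<ge> 0"
      using powr_midpoint[of x S "p+1"] x assms by (auto intro!: mult_nonneg_nonneg)
    ultimately show "\<exists>y. (?G has_real_derivative y) (at x) \<and> 0 \<le> y" by blast
  qed
  then show ?thesis by simp
qed

text \<open>A primitive of \<open>- t powr (-p)\<close>. At \<open>p = d / 2\<close>, applied to the
  squared radius, it is a multiple of the Newtonian kernel, and of the logarithm for d = 2; working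
  with its differences treats all dimensions alike.\<close>

definition primit :: "real \<Rightarrow> real \<Rightarrow> real" where
  "primit p t = (if p = 1 then - ln t else t powr (1 - p) / (p - 1))"

lemma primit_deriv [derivative_intros]:
  assumes "t > 0"
  shows "(primit p has_real_derivative - (t powr (-p))) (at t)"
proof (cases "p = 1")
  case True
  then show ?thesis unfolding primit_def using assms
    by (auto intro!: derivative_eq_intros simp: powr_minus divide_inverse)
next
  case False
  have "((\<lambda>t. t powr (1 - p) / (p - 1)) has_real_derivative (1 - p) * t powr (1 - p - 1) / (p - 1)) (at t)"
    using assms by (intro DERIV_cdivide has_real_derivative_powr)
  moreover have "(1 - p) * t powr (1 - p - 1) / (p - 1) = - (t powr (-p))"
    using False by (simp add: divide_simps) (simp add: algebra_simps)
  ultimately show ?thesis using False by (simp add: primit_def[abs_def])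
qed

lemma primit_le:
  assumes "0 < s" "s \<le> t"
  shows "primit p t \<le> primit p s"
proof -
  have "\<exists>y. (primit p has_real_derivative y) (at x) \<and> y \<le> 0" if "s \<le> x" "x \<le> t" for x
    using primit_deriv[of x p] that assms by (auto intro!: exI)
  then show ?thesis by (rule DERIV_nonpos_imp_nonincreasing[OF assms(2)]) 
qed

lemma primit_diff:
  assumes "0 < s" "s < t" "p \<ge> 0"
  shows "(t - s) * t powr (-p) \<le> primit p s - primit p t"
    and "primit p s - primit p t \<le> (t - s) * s powr (-p)"
proof -
  have "\<exists>z. s < z \<and> z < t \<and> primit p t - primit p s = (t - s) * (- (z powr (-p)))"
    by (rule MVT2[OF assms(2)]) (use assms primit_deriv in auto)
  then obtain z where z: "s < z" "z < t" "primit p t - primit p s = (t - s) * (- (z powr (-p)))"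
    by blast
  have "t powr (-p) \<le> z powr (-p)" "z powr (-p) \<le> s powr (-p)"
    using z assms by (auto intro!: powr_mono2')
  then have "(t - s) * t powr (-p) \<le> (t - s) * z powr (-p)" "(t - s) * z powr (-p) \<le> (t - s) * s powr (-p)"
    using assms by (auto intro!: mult_left_mono)
  with z(3) show "(t - s) * t powr (-p) \<le> primit p s - primit p t"
    and "primit p s - primit p t \<le> (t - s) * s powr (-p)" by linarith+
qed

text \<open>The second derivative of \<open>primit p\<close> is \<open>p * t powr (-p-1)\<close>,
  again convex, so the symmetric second difference is at least its quadratic Taylor term. The proof
  integrates \<open>powr_diff_ge\<close> in \<open>b\<close>.\<close>

lemma primit_second_difference:
  fixes p b S :: real
  assumes "\<bar>b\<bar> < S" "p \<ge> 0"
  shows "2 * primit p S + b\<^sup>2 * p * S powr (-p-1) \<le> primit p (S + b) + primit p (S - b)"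
proof -
  have *: "2 * primit p S + b\<^sup>2 * p * S powr (-p-1) \<le> primit p (S + b) + primit p (S - b)"
    if "0 \<le> b" "b < S" for b
  proof -
    let ?G = "\<lambda>b. primit p (S + b) + primit p (S - b) - b\<^sup>2 * p * S powr (-p-1)"
    have "?G 0 \<le> ?G b"
    proof (rule DERIV_nonneg_imp_nondecreasing[OF that(1)])
      fix x assume x: "0 \<le> x" "x \<le> b"
      have 1: "((\<lambda>x. primit p (S + x)) has_real_derivative - ((S + x) powr (-p)) * 1) (at x)"
        by (rule DERIV_chain2[OF primit_deriv]) (use x that in \<open>auto intro!: derivative_eq_intros\<close>)
      have 2: "((\<lambda>x. primit p (S - x)) has_real_derivative - ((S - x) powr (-p)) * (-1)) (at x)"
        by (rule DERIV_chain2[OF primit_deriv]) (use x that in \<open>auto intro!: derivative_eq_intros\<close>)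
      have "(?G has_real_derivative (S - x) powr (-p) - (S + x) powr (-p) - 2 * x * p * S powr (-p-1)) (at x)"
        by (rule derivative_eq_intros 1 2 refl)+ simp
      moreover have "0 \<le> (S - x) powr (-p) - (S + x) powr (-p) - 2 * x * p * S powr (-p-1)"
        using powr_diff_ge[of x S p] x that assms(2) by simp
      ultimately show "\<exists>y. (?G has_real_derivative y) (at x) \<and> 0 \<le> y" by blast
    qed
    then show ?thesis by simp
  qed
  show ?thesis
  proof (cases "b \<ge> 0")
    case True
    then show ?thesis using * assms by simp
  next
    case False
    then show ?thesis using *[of "- b"] assms by (simp add: add.commute)
  qed
qed

section \<open>Subharmonicity of the fundamental profile\<close>

lemma lap_primit_ge:
  fixes x :: "int ^ 'd::finite"
  assumes "p \<ge> 0"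
  shows "- ((1 + sqn x) powr (-p)) + 2 * p * sqn x / real CARD('d) * (2 + sqn x) powr (-p-1)
    \<le> lap (\<lambda>x. primit p (1 + sqn x)) x"
proof -
  \<comment> \<open>The two neighbours in direction \<open>i\<close> have arguments \<open>S\<close>
    plus or minus \<open>2 * x $ i\<close>, symmetric about \<open>S\<close>, whereas
    \<open>x\<close> itself has argument \<open>S - 1\<close>; this offset produces the negative
    term of the bound.\<close>
  define S where "S = 2 + sqn x"
  have S: "S \<ge> 2" using sqn_nonneg[of x] by (simp add: S_def)
  have "2 * primit p S + (2 * real_of_int (x $ i))\<^sup>2 * p * S powr (-p-1)
    \<le> primit p (1 + sqn (x + axis i 1)) + primit p (1 + sqn (x - axis i 1))" for i
  proof -
    have "(real_of_int (x $ i))\<^sup>2 \<le> sqn x" 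
      unfolding sqn_def by (rule member_le_sum) auto
    moreover have "(\<bar>real_of_int (x $ i)\<bar> - 1)\<^sup>2 \<ge> 0" by simp
    ultimately have "\<bar>2 * real_of_int (x $ i)\<bar> < S"
      by (simp add: S_def power2_eq_square algebra_simps)
    from primit_second_difference[OF this assms] show ?thesis
      by (simp add: S_def sqn_add_axis sqn_diff_axis algebra_simps)
  qed
  then have "(\<Sum>i\<in>UNIV. 2 * primit p S + (2 * real_of_int (x $ i))\<^sup>2 * p * S powr (-p-1))
     \<le> (\<Sum>i\<in>UNIV. primit p (1 + sqn (x + axis i 1)) + primit p (1 + sqn (x - axis i 1)))"
    by (rule sum_mono)
  also have "(\<Sum>i\<in>UNIV. 2 * primit p S + (2 * real_of_int (x $ i))\<^sup>2 * p * S powr (-p-1))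
    = real CARD('d) * (2 * primit p S) + 4 * sqn x * p * S powr (-p-1)"
    by (simp add: sum.distrib sqn_def sum_distrib_right sum_distrib_left power_mult_distrib)
  finally have "(real CARD('d) * (2 * primit p S) + 4 * sqn x * p * S powr (-p-1)) / (2 * real CARD('d))
      - primit p (1 + sqn x) \<le> lap (\<lambda>x. primit p (1 + sqn x)) x"
    unfolding lap_def by (intro diff_right_mono divide_right_mono) auto
  moreover have "(real CARD('d) * (2 * primit p S) + 4 * sqn x * p * S powr (-p-1)) / (2 * real CARD('d))
    = primit p S + 2 * p * sqn x / real CARD('d) * S powr (-p-1)"
    by (simp add: field_simps)
  moreover have "primit p (1 + sqn x) - primit p S \<le> (1 + sqn x) powr (-p)"
    using primit_diff(2)[of "1 + sqn x" S p] S assms by (simp add: S_def)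
  ultimately show ?thesis unfolding S_def by linarith
qed

text \<open>The exponents are such that \<open>|x|\<^sup>2\<^sup>-\<^sup>d\<close> is harmonic in the continuum; the second, faster
  decaying term absorbs the discretisation error.\<close>

definition fund :: "int ^ 'd::finite \<Rightarrow> real" where
  "fund x = primit (real CARD('d) / 2) (1 + sqn x) + primit ((real CARD('d) + 1) / 2) (1 + sqn x)"

text \<open>For \<open>p = d / 2\<close> the leading terms of \<open>lap_primit_ge\<close> cancel
  and leave an error of order \<open>S powr (-p-1)\<close>. For \<open>p' = p + 1/2\<close> the
  factor \<open>2 * p' / d = 1 + 1 / d\<close> leaves a gain \<open>S powr (-p') / d\<close>, larger
  in order by \<open>sqrt S\<close>. It wins once \<open>sqrt S \<ge> d * C\<close>, whence the
  choice of \<open>M\<close>.\<close>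

lemma fund_subharmonic_far:
  assumes "CARD('d::finite) \<ge> 2"
  obtains M where "M > 0" "\<And>x :: int ^ 'd. sqn x \<ge> M \<Longrightarrow> lap fund x \<ge> 0"
proof -
  define d p where "d = real CARD('d)" and "p = d / 2"
  have d: "d \<ge> 2" using assms by (simp add: d_def)
  have p1: "p \<ge> 1" using d by (simp add: p_def)
  define C where "C = p * 2 powr (p + 1) + (p + 1/2) * 2 powr (p + 3/2) + 2 + 4 * (p + 1/2) / d"
  define M where "M = (d * C)\<^sup>2"
  have "C > 0" using p1 d by (auto simp: C_def intro!: add_nonneg_pos add_pos_nonneg)
  then have M: "M > 0" using d by (simp add: M_def)
  have "lap fund x \<ge> 0" if x: "sqn x \<ge> M" for x :: "int ^ 'd"
  proof -
    define S where "S = 2 + sqn x"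
    have S: "S \<ge> 2" using sqn_nonneg[of x] by (simp add: S_def)
    have shift: "(S - 1) powr (-q) \<le> S powr (-q) + q * 2 powr (q + 1) * S powr (-q - 1)" if "q > 0" for q
    proof -
      have "(S - 1) powr (-q) - S powr (-q) \<le> q * (S - 1) powr (- q - 1)"
      proof -
        have "\<exists>z. S - 1 < z \<and> z < S \<and> S powr (-q) - (S - 1) powr (-q) = (S - (S - 1)) * ((-q) * z powr (-q - 1))"
          by (rule MVT2) (use S in \<open>auto intro!: derivative_eq_intros\<close>)
        then obtain z where z: "S - 1 < z" "z < S" "S powr (-q) - (S - 1) powr (-q) = - q * z powr (-q - 1)"
          by auto
        have "z powr (- q - 1) \<le> (S - 1) powr (- q - 1)"
          using z S that by (intro powr_mono2') auto
        then have "q * z powr (- q - 1) \<le> q * (S - 1) powr (- q - 1)"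
          using that by (intro mult_left_mono) auto
        with z(3) show ?thesis by linarith
      qed
      also have "(S - 1) powr (-q - 1) \<le> (S / 2) powr (-q - 1)"
        using S that by (intro powr_mono2') auto
      also have "(S / 2) powr (-q - 1) = 2 powr (q + 1) * S powr (-q - 1)"
        using S powr_add[of 2 "q + 1" "- q - 1"] by (simp add: powr_divide field_simps)
      finally show ?thesis using that by (simp add: mult_left_mono algebra_simps)
    qed
    define p' where "p' = p + 1/2"
    define a b e where "a = S powr (-p-1)" and "b = S powr (-p'-1)" and "e = S powr (-p')"
    have pos: "a > 0" "b > 0" "e > 0" using S by (auto simp: a_def b_def e_def)
    have ba: "b \<le> a" unfolding a_def b_def p'_def using S by (intro powr_mono) auto
    have Sa: "S powr (-p) = S * a" and Sb: "e = S * b"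
      using S by (simp_all add: a_def b_def e_def powr_diff)
    have ea: "e = sqrt S * a"
      using S powr_add[of S "1/2" "- p - 1"]
      by (simp add: a_def e_def p'_def powr_half_sqrt[symmetric] algebra_simps)
    have 1: "lap (\<lambda>x. primit p (1 + sqn x)) x \<ge> - (p * 2 powr (p + 1) + 2) * a"
    proof -
      have "- ((S - 1) powr (-p)) + (S - 2) * a \<le> lap (\<lambda>x. primit p (1 + sqn x)) x"
        using lap_primit_ge[of p x] p1 d by (simp add: S_def a_def p_def d_def)
      moreover have "(S - 1) powr (-p) \<le> S * a + p * 2 powr (p + 1) * a"
        using shift[of p] p1 by (simp add: Sa[symmetric]) (simp add: a_def)
      ultimately show ?thesis by (simp add: algebra_simps)
    qed
    have 2: "lap (\<lambda>x. primit p' (1 + sqn x)) x \<ge> e / d - (p' * 2 powr (p' + 1) + 4 * p' / d) * b"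
    proof -
      have "- ((S - 1) powr (-p')) + 2 * p' / d * (S - 2) * b \<le> lap (\<lambda>x. primit p' (1 + sqn x)) x"
        using lap_primit_ge[of p' x] p1 d by (simp add: S_def b_def p'_def d_def)
      moreover have "(S - 1) powr (-p') \<le> e + p' * 2 powr (p' + 1) * b"
        using shift[of p'] p1 by (simp add: e_def b_def p'_def)
      moreover have "2 * p' / d * (S - 2) * b = e + e / d - 4 * p' / d * b"
        using d by (simp add: p'_def p_def Sb field_simps)
      ultimately show ?thesis by (simp add: algebra_simps)
    qed
    have "(p' * 2 powr (p' + 1) + 4 * p' / d) * b \<le> (p' * 2 powr (p' + 1) + 4 * p' / d) * a"
      using ba p1 d by (intro mult_left_mono add_nonneg_nonneg) (auto simp: p'_def)
    moreover have "C = p * 2 powr (p + 1) + 2 + (p' * 2 powr (p' + 1) + 4 * p' / d)"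
      by (simp add: C_def p'_def add.commute add.left_commute)
    ultimately have 3: "lap (\<lambda>x. primit p (1 + sqn x)) x + lap (\<lambda>x. primit p' (1 + sqn x)) x \<ge> e / d - C * a"
      using 1 2 by (simp add: algebra_simps)
    have "d * C \<le> sqrt S"
      using x sqn_nonneg[of x] by (intro real_le_rsqrt) (simp add: S_def M_def)
    then have "C * a \<le> e / d"
      using d pos by (simp add: ea field_simps mult_right_mono)
    have fe: "fund = (\<lambda>x :: int ^ 'd. primit p (1 + sqn x) + primit p' (1 + sqn x))"
      by (rule ext) (simp add: fund_def p_def p'_def d_def add_divide_distrib)
    have "lap fund x = lap (\<lambda>x. primit p (1 + sqn x)) x + lap (\<lambda>x. primit p' (1 + sqn x)) x"
      unfolding fe by (rule lap_add)
    with 3 \<open>C * a \<le> e / d\<close> show ?thesis by linarith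
  qed
  with M show ?thesis using that by blast
qed

definition l1 :: "int ^ 'd::finite \<Rightarrow> nat" where
  "l1 x = nat (\<Sum>i\<in>UNIV. \<bar>x $ i\<bar>)"

lemma real_l1: "real (l1 x) = (\<Sum>i\<in>UNIV. \<bar>real_of_int (x $ i)\<bar>)"
  by (simp add: l1_def sum_nonneg)

lemma len_le_l1: "len x \<le> real (l1 x)"
  using norm_le_l1_cart[of "to_real x"] by (simp add: len_def real_l1 to_real_def)

lemma ex_l1_smaller_neighbour:
  assumes "x \<noteq> (0 :: int ^ 'd::finite)"
  obtains i y where "y = x + axis i 1 \<or> y = x - axis i 1" "l1 x = Suc (l1 y)"
proof -
  from assms obtain i where i: "x $ i \<noteq> 0" by (auto simp: vec_eq_iff)
  define y where "y = (if x $ i > 0 then x - axis i 1 else x + axis i 1)"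
  have "(\<Sum>j\<in>UNIV. \<bar>x $ j\<bar> - \<bar>y $ j\<bar>) = (\<Sum>j\<in>UNIV. if j = i then 1 else 0)"
    using i by (intro sum.cong) (auto simp: y_def axis_def)
  then have "(\<Sum>j\<in>UNIV. \<bar>x $ j\<bar>) = (\<Sum>j\<in>UNIV. \<bar>y $ j\<bar>) + 1"
    by (simp add: sum_subtractf)
  moreover have "(\<Sum>j\<in>UNIV. \<bar>y $ j\<bar>) \<ge> 0" by (simp add: sum_nonneg)
  ultimately have "l1 x = Suc (l1 y)" by (simp add: l1_def nat_add_distrib)
  moreover have "y = x + axis i 1 \<or> y = x - axis i 1" by (simp add: y_def)
  ultimately show ?thesis using that by blast
qed

text \<open>A multiple of \<open>peak\<close> repairs \<open>fund\<close> at the finitely many sites other than \<open>0\<close> where it is not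
  subharmonic.\<close>

definition peak :: "int ^ 'd::finite \<Rightarrow> real" where
  "peak x = (1 / 2 ^ (CARD('d) + 2)) ^ l1 x"

lemma peak_pos: "peak x > 0"
  by (simp add: peak_def)

text \<open>One neighbour is closer to the origin in \<open>l1\<close>, and its value is larger by
  the factor \<open>2 ^ (d + 2) \<ge> 4 * d\<close>; its share \<open>1 / (2 * d)\<close> of the
  average alone is at least \<open>2 * peak x\<close>.\<close>

lemma lap_peak_ge:
  fixes x :: "int ^ 'd::finite"
  assumes "x \<noteq> 0"
  shows "lap peak x \<ge> peak x"
proof -
  obtain i y where y: "y = x + axis i 1 \<or> y = x - axis i 1" "l1 x = Suc (l1 y)"
    using ex_l1_smaller_neighbour[OF assms] by blast
  have "lap peak x \<ge> peak y / (2 * real CARD('d)) - peak x"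
    using y(1) by (intro lap_ge_single) (auto simp: less_imp_le[OF peak_pos])
  moreover have "peak y = 2 ^ (CARD('d) + 2) * peak x"
    using y(2) by (simp add: peak_def)
  moreover have pos: "2 * real CARD('d) > 0" by simp
  have "real CARD('d) \<le> 2 ^ CARD('d)"
    using of_nat_less_two_power[of "CARD('d)", where ?'a = real] by simp
  then have "2 * peak x * (2 * real CARD('d)) \<le> 2 ^ (CARD('d) + 2) * peak x"
  proof -
    assume "real CARD('d) \<le> 2 ^ CARD('d)"
    then have "real CARD('d) * peak x \<le> 2 ^ CARD('d) * peak x"
      using peak_pos[of x] by (intro mult_right_mono) auto
    moreover have "2 * peak x * (2 * real CARD('d)) = 4 * (real CARD('d) * peak x)"
      "2 ^ (CARD('d) + 2) * peak x = 4 * (2 ^ CARD('d) * peak x)" by simp_all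
    ultimately show ?thesis by linarith
  qed
  then have "2 * peak x \<le> 2 ^ (CARD('d) + 2) * peak x / (2 * real CARD('d))"
    by (simp only: pos_le_divide_eq[OF pos])
  ultimately show ?thesis by simp
qed

text \<open>Since \<open>R \<le> 2 ^ l1 x\<close>, the base chosen for \<open>peak\<close> also
  beats the decay of the correction term in \<open>fund\<close>.\<close>

lemma peak_le:
  fixes x :: "int ^ 'd::finite"
  assumes "1 \<le> R" "R \<le> len x"
  shows "peak x \<le> 1 / R ^ (CARD('d) - 1)"
proof -
  have "R \<le> 2 ^ l1 x"
    using assms len_le_l1[of x] of_nat_less_two_power[of "l1 x", where ?'a = real] by linarith
  then have "R ^ (CARD('d) - 1) \<le> (2 ^ l1 x) ^ (CARD('d) - 1)"
    using assms by (intro power_mono) auto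
  also have "\<dots> \<le> (2 ^ l1 x) ^ (CARD('d) + 2)"
    by (intro power_increasing) auto
  finally have "1 / (2 ^ l1 x) ^ (CARD('d) + 2) \<le> 1 / R ^ (CARD('d) - 1)"
    using assms by (intro divide_left_mono) auto
  moreover have "((2 :: real) ^ (CARD('d) + 2)) ^ l1 x = (2 ^ l1 x) ^ (CARD('d) + 2)"
    by (metis power_mult mult.commute)
  ultimately show ?thesis
    by (simp only: peak_def power_one_over)
qed

lemma fund_correction:
  assumes "CARD('d::finite) \<ge> 2"
  obtains L where "L > 0" "\<And>x :: int ^ 'd. x \<noteq> 0 \<Longrightarrow> lap (\<lambda>x. fund x + L * peak x) x \<ge> 0"
proof -
  obtain M where M: "M > 0" "\<And>x :: int ^ 'd. sqn x \<ge> M \<Longrightarrow> lap fund x \<ge> 0"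
    using fund_subharmonic_far[OF assms] by blast
  define F where "F = {x :: int ^ 'd. sqn x < M}"
  have "F \<subseteq> {x. len (x - 0) \<le> sqrt M}"
    by (auto simp: F_def len_sq[symmetric] intro!: real_le_rsqrt)
  then have F: "finite F" using finite_len_le finite_subset by blast
  \<comment> \<open>The sum of the finitely many ratios serves as a bound for each of them.\<close>
  define L where "L = 1 + (\<Sum>x\<in>F. \<bar>lap fund x\<bar> / peak x)"
  have L: "L > 0" by (auto simp: L_def intro!: add_pos_nonneg sum_nonneg divide_nonneg_pos peak_pos)
  have "lap fund x + L * lap peak x \<ge> 0" if x: "x \<noteq> 0" for x :: "int ^ 'd"
  proof (cases "x \<in> F")
    case True
    have "\<bar>lap fund x\<bar> / peak x \<le> (\<Sum>x\<in>F. \<bar>lap fund x\<bar> / peak x)"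
      using True F by (intro member_le_sum) (auto intro!: divide_nonneg_pos peak_pos)
    then have "\<bar>lap fund x\<bar> / peak x \<le> L" by (simp add: L_def)
    then have "\<bar>lap fund x\<bar> \<le> L * peak x" using peak_pos[of x] by (simp add: pos_divide_le_eq)
    also have "\<dots> \<le> L * lap peak x" using L lap_peak_ge[OF x] by simp
    finally show ?thesis by linarith
  next
    case False
    then have "lap fund x \<ge> 0" using M by (simp add: F_def)
    moreover have "lap peak x \<ge> 0" using lap_peak_ge[OF x] peak_pos[of x] by linarith
    ultimately show ?thesis using L by simp
  qed
  then show ?thesis using that[of L] L by (simp add: lap_add lap_cmult)
qed

section \<open>The truncated test function\<close>

lemma primit_nonneg:
  assumes "p > 1"
  shows "primit p t \<ge> 0"
  using assms by (simp add: primit_def)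

text \<open>Mean value theorem between \<open>1 + \<sigma>^2\<close> and its double, which does not
  exceed \<open>1 + R^2\<close>. The drop is of order \<open>\<sigma>^(2-d)\<close> also in the
  logarithmic case, where the values themselves do not decay.\<close>

lemma primit_gap:
  fixes \<sigma> R :: real
  assumes "\<sigma> \<ge> 1" "R \<ge> 2 * \<sigma>"
  shows "(1 / 2 ^ k) * (\<sigma>\<^sup>2 / \<sigma> ^ k) \<le> primit (real k / 2) (1 + \<sigma>\<^sup>2) - primit (real k / 2) (1 + R\<^sup>2)"
proof -
  define p where "p = real k / 2"
  have s1: "\<sigma>\<^sup>2 \<ge> 1" using assms by simp
  have "(2 * \<sigma>)\<^sup>2 \<le> R\<^sup>2" using assms by (intro power_mono) auto
  then have "2 * (1 + \<sigma>\<^sup>2) \<le> 1 + R\<^sup>2" using s1 by (simp add: power_mult_distrib)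
  then have 1: "primit p (1 + R\<^sup>2) \<le> primit p (2 * (1 + \<sigma>\<^sup>2))"
    using s1 by (intro primit_le) auto
  have "(2 * (1 + \<sigma>\<^sup>2) - (1 + \<sigma>\<^sup>2)) * (2 * (1 + \<sigma>\<^sup>2)) powr (-p) \<le> primit p (1 + \<sigma>\<^sup>2) - primit p (2 * (1 + \<sigma>\<^sup>2))"
    using s1 by (intro primit_diff) (auto simp: p_def)
  moreover have *: "((2 * \<sigma>) powr 2) powr (-p) \<le> (2 * (1 + \<sigma>\<^sup>2)) powr (-p)"
    using s1 assms by (intro powr_mono2') (auto simp: p_def power_mult_distrib add_pos_nonneg)
  then have "1 / (2 * \<sigma>) ^ k \<le> (2 * (1 + \<sigma>\<^sup>2)) powr (-p)"
  proof -
    have "((2 * \<sigma>) powr 2) powr (-p) = 1 / (2 * \<sigma>) ^ k"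
      unfolding powr_powr p_def using assms by (simp add: powr_minus_divide powr_realpow)
    then show ?thesis using * by simp
  qed
  then have "\<sigma>\<^sup>2 * (1 / (2 * \<sigma>) ^ k) \<le> (1 + \<sigma>\<^sup>2) * (2 * (1 + \<sigma>\<^sup>2)) powr (-p)"
    using assms by (intro mult_mono) auto
  ultimately show ?thesis using 1 by (simp add: p_def power_mult_distrib)
qed

text \<open>At radius \<open>R\<close> the correction term has size \<open>R^(1-d)\<close>, one
  power less than the drop in \<open>primit_gap\<close>, so a large ratio of \<open>R\<close> to
  \<sigma> makes it negligible. The factor \<open>2\<close> is attained by
  \<open>1 / ((k - 1) / 2)\<close> at \<open>k = 2\<close>.\<close>

lemma primit_correction_le:
  fixes R t :: real
  assumes "k \<ge> 2" "R \<ge> 1" "R\<^sup>2 \<le> t"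
  shows "primit ((real k + 1) / 2) t \<le> 2 / R ^ (k - 1)"
proof -
  have "primit ((real k + 1) / 2) t = t powr (- ((real k - 1) / 2)) / ((real k - 1) / 2)"
  proof -
    have "1 - (real k + 1) / 2 = - ((real k - 1) / 2)" "(real k + 1) / 2 - 1 = (real k - 1) / 2"
      "(real k + 1) / 2 \<noteq> 1"
      using assms by (auto simp: field_simps)
    then show ?thesis by (simp only: primit_def if_False)
  qed
  also have "\<dots> \<le> (R powr 2) powr (- ((real k - 1) / 2)) / ((real k - 1) / 2)"
    using assms by (intro divide_right_mono powr_mono2') auto
  also have "\<dots> = (1 / R ^ (k - 1)) / ((real k - 1) / 2)"
  proof -
    have "(R powr 2) powr (- ((real k - 1) / 2)) = R powr (- real (k - 1))"
      unfolding powr_powr using assms by (simp add: of_nat_diff diff_divide_distrib)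
    also have "\<dots> = 1 / R ^ (k - 1)"
      unfolding powr_minus_divide using assms by (subst powr_realpow) auto
    finally show ?thesis by (simp only:)
  qed
  also have "\<dots> \<le> (1 / R ^ (k - 1)) / (1 / 2)"
    using assms by (intro divide_left_mono) auto
  finally show ?thesis by simp
qed

text \<open>The Laplacian can be negative only at the origin, and there by at most a constant
  independent of the scale. The last two clauses have the natural scaling of a kernel of order
  \<open>|x|^(2-d)\<close>: the Laplacian bound will control a sum of a superharmonic
  \<open>w\<close>, the bound on \<open>H\<close> a single value of \<open>- lap w\<close>.\<close>

definition cutoff :: "real \<Rightarrow> real \<Rightarrow> real \<Rightarrow> real \<Rightarrow> (int ^ 'd::finite \<Rightarrow> real) \<Rightarrow> bool" where
  "cutoff B C \<theta> \<sigma> H \<longleftrightarrow>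
    (\<forall>x. H x \<ge> 0) \<and> (\<forall>x. len x \<ge> B * \<sigma> \<longrightarrow> H x = 0) \<and>
    (\<forall>x. x \<noteq> 0 \<longrightarrow> lap H x \<ge> 0) \<and> lap H 0 \<ge> - C \<and>
    (\<forall>x. x \<noteq> 0 \<and> len x \<le> \<sigma> \<longrightarrow> lap H x \<ge> \<theta> / \<sigma> ^ CARD('d)) \<and>
    (\<forall>x. len x \<le> \<sigma> \<longrightarrow> H x \<ge> \<theta> * (\<sigma>\<^sup>2 / \<sigma> ^ CARD('d)))"

text \<open>Truncation at zero is harmless for lower bounds on the Laplacian: where \<open>H\<close>
  vanishes, its Laplacian is nonnegative because \<open>H\<close> is; where \<open>H = h\<close>,
  passing from \<open>h\<close> to \<open>H\<close> only raises the neighbours. The quadratic term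
  supplies the strict bound on the inner ball.\<close>

lemma test_function:
  assumes "CARD('d::finite) \<ge> 2"
  obtains B C \<theta> :: real where "B \<ge> 1" "C > 0" "\<theta> > 0"
    "\<And>\<sigma>. \<sigma> \<ge> 1 \<Longrightarrow> \<exists>H :: int ^ 'd \<Rightarrow> real. cutoff B C \<theta> \<sigma> H"
proof -
  let ?d = "CARD('d)"
  define c0 :: real where "c0 = 1 / 2 ^ ?d"
  have c0: "0 < c0" "c0 \<le> 1" by (auto simp: c0_def)
  obtain L where L: "L > 0" "\<And>x :: int ^ 'd. x \<noteq> 0 \<Longrightarrow> lap (\<lambda>x. fund x + L * peak x) x \<ge> 0"
    using fund_correction[OF assms] by blast
  define g where "g = (\<lambda>x :: int ^ 'd. fund x + L * peak x)"
  \<comment> \<open>At radius \<open>B * \<sigma>\<close> the correction term (factor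
    \<open>2\<close>) and \<open>peak\<close> (factor \<open>L\<close>) together use at most a
    quarter of the gap \<open>c0 * E\<close>.\<close>
  define B where "B = 4 * (2 + L) / c0"
  have "B \<ge> 4 * (2 + L) / 1" unfolding B_def using c0 L by (intro divide_left_mono) auto
  then have B: "B \<ge> 2" using L by simp
  \<comment> \<open>Likewise the quadratic term, taken out to radius
    \<open>R + 1 \<le> (B + 1) * \<sigma>\<close>, uses at most another quarter.\<close>
  define \<theta> where "\<theta> = c0 / (4 * (B + 1)\<^sup>2)"
  have \<theta>: "\<theta> > 0" using c0 B by (simp add: \<theta>_def)
  have \<theta>B: "\<theta> * (B + 1)\<^sup>2 = c0 / 4" using B by (simp add: \<theta>_def)
  have "\<theta> * 1 \<le> \<theta> * (B + 1)\<^sup>2" using \<theta> B by (intro mult_left_mono) auto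
  then have \<theta>c: "\<theta> \<le> c0 / 2" using \<theta>B c0 by simp
  define C where "C = 1 + \<bar>lap g 0\<bar>"
  have "\<exists>H :: int ^ 'd \<Rightarrow> real. cutoff B C \<theta> \<sigma> H" if \<sigma>: "\<sigma> \<ge> 1" for \<sigma> :: real
  proof -
    define R where "R = B * \<sigma>"
    define E where "E = \<sigma>\<^sup>2 / \<sigma> ^ ?d"
    have E: "E > 0" using \<sigma> by (simp add: E_def)
    have R: "R \<ge> 2 * \<sigma>" using B \<sigma> by (simp add: R_def mult_right_mono)
    define P where "P = primit (real ?d / 2) (1 + R\<^sup>2)"
    \<comment> \<open>The middle of the gap: outside, \<open>h\<close> before subtraction is at most
      \<open>P\<close> plus two quarters of \<open>c0 * E\<close>; inside, it is at least
      \<open>P + c0 * E\<close>.\<close>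
    define \<kappa> where "\<kappa> = P + c0 / 2 * E"
    define h where "h = (\<lambda>x. g x + \<theta> / \<sigma> ^ ?d * sqn x - \<kappa>)"
    have lap_h: "lap h x = lap g x + \<theta> / \<sigma> ^ ?d" for x
      unfolding h_def lap_diff lap_add lap_cmult lap_const lap_sqn by simp
    define H where "H = (\<lambda>x. if len x < R then max 0 (h x) else 0)"
    have tail: "(2 + L) / R ^ (?d - 1) \<le> c0 / 4 * E"
    proof -
      obtain k where k: "?d = Suc (Suc k)" using assms by (metis Suc_le_D numeral_2_eq_2 Suc_le_mono)
      have "(2 + L) / R ^ (?d - 1) = (2 + L) / (B * B ^ k * (\<sigma> * \<sigma> ^ k))"
        by (simp add: R_def k power_mult_distrib)
      also have "\<dots> \<le> (2 + L) / (B * 1 * (1 * \<sigma> ^ k))"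
        using L B \<sigma> by (intro divide_left_mono mult_mono mult_pos_pos) (auto intro!: mult_pos_pos)
      also have "\<dots> = (2 + L) / B * (1 / \<sigma> ^ k)" by simp
      also have "(2 + L) / B = c0 / 4" using c0 L by (simp add: B_def field_simps)
      also have "1 / \<sigma> ^ k = E" using \<sigma> by (simp add: E_def k power2_eq_square)
      finally show ?thesis .
    qed
    \<comment> \<open>A shell of width \<open>1\<close> suffices, since a neighbour of a site in the
      ball of radius \<open>R\<close> lies in the ball or in this shell.\<close>
    have outer: "h x \<le> 0" if "R \<le> len x" "len x \<le> R + 1" for x
    proof -
      have x2: "R\<^sup>2 \<le> sqn x" using that R \<sigma> by (simp add: power_mono flip: len_sq)
      have "primit (real ?d / 2) (1 + sqn x) \<le> P"
        unfolding P_def using x2 by (intro primit_le) (auto intro: add_pos_nonneg)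
      moreover have "primit ((real ?d + 1) / 2) (1 + sqn x) \<le> 2 / R ^ (?d - 1)"
        using assms R \<sigma> x2 by (intro primit_correction_le) auto
      moreover have "L * peak x \<le> L * (1 / R ^ (?d - 1))"
        using L R \<sigma> that by (intro mult_left_mono peak_le) auto
      ultimately have "g x \<le> P + (2 + L) / R ^ (?d - 1)"
        by (simp add: g_def fund_def add_divide_distrib)
      moreover have "\<theta> / \<sigma> ^ ?d * sqn x \<le> c0 / 4 * E"
      proof -
        have "len x \<le> (B + 1) * \<sigma>" using that \<sigma> by (simp add: R_def algebra_simps)
        then have "sqn x \<le> ((B + 1) * \<sigma>)\<^sup>2"
          using len_nonneg[of x] by (simp add: power_mono flip: len_sq)
        then have "\<theta> / \<sigma> ^ ?d * sqn x \<le> \<theta> / \<sigma> ^ ?d * ((B + 1) * \<sigma>)\<^sup>2"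
          using \<theta> \<sigma> by (intro mult_left_mono) auto
        also have "\<dots> = \<theta> * (B + 1)\<^sup>2 * E" by (simp add: E_def power_mult_distrib)
        finally show ?thesis by (simp add: \<theta>B)
      qed
      ultimately show ?thesis using tail unfolding h_def \<kappa>_def by linarith
    qed
    have inner: "h x \<ge> c0 / 2 * E" if "len x \<le> \<sigma>" for x
    proof -
      have "sqn x \<le> \<sigma>\<^sup>2" using that len_nonneg[of x] by (simp add: power_mono flip: len_sq)
      then have "primit (real ?d / 2) (1 + \<sigma>\<^sup>2) \<le> primit (real ?d / 2) (1 + sqn x)"
        using sqn_nonneg[of x] by (intro primit_le) auto
      moreover have "c0 * E \<le> primit (real ?d / 2) (1 + \<sigma>\<^sup>2) - P"
        unfolding c0_def E_def P_def using \<sigma> R by (rule primit_gap)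
      moreover have "primit ((real ?d + 1) / 2) (1 + sqn x) \<ge> 0"
        using assms by (intro primit_nonneg) auto
      moreover have "L * peak x \<ge> 0" "\<theta> / \<sigma> ^ ?d * sqn x \<ge> 0"
        using L peak_pos[of x] \<theta> \<sigma> sqn_nonneg[of x] by simp_all
      ultimately show ?thesis unfolding h_def \<kappa>_def g_def fund_def by linarith
    qed
    have H0: "H x \<ge> 0" for x by (simp add: H_def)
    have H_lap0: "lap H x \<ge> - H x" for x by (rule lap_ge_neg) (auto simp: H0)
    have H_lap: "lap H x \<ge> lap h x" if "len x < R" "h x \<ge> 0" for x
    proof (rule lap_mono)
      show "h x = H x" using that by (simp add: H_def)
      have "h y \<le> H y" if "len y \<le> R + 1" for y
        using outer[of y] that by (auto simp: H_def)
      moreover have "len (x + axis i 1) \<le> R + 1" "len (x - axis i 1) \<le> R + 1" for i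
        using len_triangle[of x "axis i 1"] len_triangle[of x "- axis i 1"] \<open>len x < R\<close>
        by (simp_all add: len_axis len_minus)
      ultimately show "h (x + axis i 1) \<le> H (x + axis i 1)" "h (x - axis i 1) \<le> H (x - axis i 1)" for i
        by blast+
    qed
    have sR: "\<sigma> < R" using R \<sigma> by linarith
    have lap_inner: "lap H x \<ge> lap g x + \<theta> / \<sigma> ^ ?d" if "len x \<le> \<sigma>" for x
    proof -
      have "0 \<le> c0 / 2 * E" using c0 E by simp
      with inner[OF that] have "0 \<le> h x" by linarith
      then show ?thesis using H_lap[of x] that sR by (simp add: lap_h)
    qed
    have g_lap: "lap g x \<ge> 0" if "x \<noteq> 0" for x using L that by (simp add: g_def)
    have pos: "\<theta> / \<sigma> ^ ?d \<ge> 0" using \<theta> \<sigma> by simp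
    have "lap H x \<ge> 0" if "x \<noteq> 0" for x
    proof (cases "len x < R \<and> h x \<ge> 0")
      case True
      then show ?thesis using H_lap[of x] g_lap[OF that] pos by (simp add: lap_h)
    next
      case False
      then have "H x = 0" by (auto simp: H_def)
      then show ?thesis using H_lap0[of x] by simp
    qed
    moreover have "lap H 0 \<ge> - C" using lap_inner[of 0] pos \<sigma> by (simp add: C_def len_0)
    moreover have "lap H x \<ge> \<theta> / \<sigma> ^ ?d" if "x \<noteq> 0" "len x \<le> \<sigma>" for x
      using lap_inner[OF that(2)] g_lap[OF that(1)] by simp
    moreover have "H x \<ge> \<theta> * E" if "len x \<le> \<sigma>" for x
    proof -
      have "\<theta> * E \<le> c0 / 2 * E" using \<theta>c E by (intro mult_right_mono) auto
      also have "\<dots> \<le> H x" using inner[OF that] that sR by (simp add: H_def)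
      finally show ?thesis .
    qed
    ultimately show ?thesis using H0 
      unfolding cutoff_def E_def by (intro exI[of _ H] conjI) (auto simp: H_def R_def)
  qed
  then show ?thesis using that[of B C \<theta>] B \<theta> by (simp add: C_def add_pos_nonneg)
qed

section \<open>Averages of superharmonic and subharmonic functions\<close>

text \<open>Testing \<open>w\<close> against the translate of \<open>H\<close> to \<open>y\<close>
  gives a nonpositive total, in which only the term at \<open>y\<close> can be negative on the side
  of \<open>lap H\<close>, by at most \<open>C * w y\<close>. Hence \<open>C * w y\<close> controls
  both the remaining terms \<open>w x * lap H (x - y)\<close> and each defect
  \<open>- H (z - y) * lap w z\<close>.\<close>

lemma weak_harnack:
  assumes "CARD('d::finite) \<ge> 2"
  obtains B C :: real where "B \<ge> 1" "C > 0"
    "\<And>\<sigma> y (w :: int ^ 'd \<Rightarrow> real).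
      \<sigma> \<ge> 1 \<Longrightarrow> (\<And>x. len (x - y) \<le> B * \<sigma> + 1 \<Longrightarrow> w x \<ge> 0) \<Longrightarrow>
      (\<And>x. len (x - y) < B * \<sigma> \<Longrightarrow> lap w x \<le> 0) \<Longrightarrow>
      (\<Sum>x | len (x - y) \<le> \<sigma>. w x) \<le> C * \<sigma> ^ CARD('d) * w y \<and>
      (\<forall>z. len (z - y) \<le> \<sigma> \<longrightarrow> - lap w z * \<sigma>\<^sup>2 \<le> C * \<sigma> ^ CARD('d) * w y)"
proof -
  let ?d = "CARD('d)"
  obtain B C \<theta> :: real where B: "B \<ge> 1" "C > 0" "\<theta> > 0" and
    test: "\<And>\<sigma>. \<sigma> \<ge> 1 \<Longrightarrow> \<exists>H :: int ^ 'd \<Rightarrow> real. cutoff B C \<theta> \<sigma> H"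
    using test_function[OF assms] by blast
  have "(\<Sum>x | len (x - y) \<le> \<sigma>. w x) \<le> (C / \<theta> + 1) * \<sigma> ^ ?d * w y \<and>
      (\<forall>z. len (z - y) \<le> \<sigma> \<longrightarrow> - lap w z * \<sigma>\<^sup>2 \<le> (C / \<theta> + 1) * \<sigma> ^ ?d * w y)"
    if \<sigma>: "\<sigma> \<ge> 1" and w: "\<And>x. len (x - y) \<le> B * \<sigma> + 1 \<Longrightarrow> w x \<ge> 0"
      and lw: "\<And>x. len (x - y) < B * \<sigma> \<Longrightarrow> lap w x \<le> 0" for \<sigma> y and w :: "int ^ 'd \<Rightarrow> real"
  proof -
    obtain H :: "int ^ 'd \<Rightarrow> real" where cut: "cutoff B C \<theta> \<sigma> H"
      using test[OF \<sigma>] by blast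
    have H: "\<And>x. H x \<ge> 0" "\<And>x. len x \<ge> B * \<sigma> \<Longrightarrow> H x = 0"
      "\<And>x. x \<noteq> 0 \<Longrightarrow> lap H x \<ge> 0" "lap H 0 \<ge> - C"
      "\<And>x. x \<noteq> 0 \<Longrightarrow> len x \<le> \<sigma> \<Longrightarrow> lap H x \<ge> \<theta> / \<sigma> ^ ?d"
      "\<And>x. len x \<le> \<sigma> \<Longrightarrow> H x \<ge> \<theta> * (\<sigma>\<^sup>2 / \<sigma> ^ ?d)"
      using cut by (simp_all add: cutoff_def)
    \<comment> \<open>\<open>lap H\<close> can be nonzero one step outside the support of
      \<open>H\<close>, hence the extra \<open>1\<close>.\<close>
    define A where "A = {x. len (x - y) \<le> B * \<sigma> + 1}"
    have A: "finite A" unfolding A_def by (rule finite_len_le)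
    have sB: "\<sigma> \<le> B * \<sigma>" using B \<sigma> by simp
    have yA: "y \<in> A" using \<sigma> sB by (simp add: A_def len_0)
    have wy: "w y \<ge> 0" using w[of y] yA by (simp add: A_def)
    have parts: "(\<Sum>x\<in>A. w x * lap H (x - y)) = (\<Sum>x\<in>A. H (x - y) * lap w x)"
    proof -
      have "(\<Sum>x\<in>A. w x * lap (\<lambda>x. H (x - y)) x) = (\<Sum>x\<in>A. H (x - y) * lap w x)"
      proof (rule sum_by_parts[OF A])
        fix x assume "H (x - y) \<noteq> 0"
        then have l: "len (x - y) < B * \<sigma>" using H(2)[of "x - y"] by fastforce
        have "len (x + axis i 1 - y) \<le> B * \<sigma> + 1" "len (x - axis i 1 - y) \<le> B * \<sigma> + 1" for i
          using len_triangle[of "x - y" "axis i 1"] len_triangle[of "x - y" "- axis i 1"] l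
          by (simp_all add: len_axis len_minus algebra_simps)
        then show "x \<in> A \<and> (\<forall>i. x + axis i 1 \<in> A \<and> x - axis i 1 \<in> A)"
          using l by (simp add: A_def)
      qed
      then show ?thesis by (simp add: lap_shift)
    qed
    have rhs_nonpos: "H (x - y) * lap w x \<le> 0" for x
      using H(1)[of "x - y"] H(2)[of "x - y"] lw[of x]
      by (cases "len (x - y) < B * \<sigma>") (auto intro: mult_nonneg_nonpos)
    have lhs_nonneg: "w x * lap H (x - y) \<ge> 0" if "x \<in> A - {y}" for x
      using that w[of x] H(3)[of "x - y"] by (auto simp: A_def)
    have lhs: "(\<Sum>x\<in>A. w x * lap H (x - y)) \<ge> - C * w y + (\<Sum>x\<in>A - {y}. w x * lap H (x - y))"
      using A yA mult_left_mono[OF H(4) wy] by (simp add: sum.remove mult.commute)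
    define D where "D = {x. len (x - y) \<le> \<sigma>}"
    have "len (x - y) \<le> B * \<sigma> + 1" if "len (x - y) \<le> \<sigma>" for x
      using that sB by linarith
    then have D: "D \<subseteq> A" "finite D" "y \<in> D"
      using finite_len_le \<sigma> by (auto simp: A_def D_def len_0)
    have "(\<Sum>x\<in>D - {y}. w x * (\<theta> / \<sigma> ^ ?d)) \<le> (\<Sum>x\<in>D - {y}. w x * lap H (x - y))"
      using D w by (intro sum_mono mult_left_mono H) (auto simp: D_def A_def)
    also have "\<dots> \<le> (\<Sum>x\<in>A - {y}. w x * lap H (x - y))"
      using A D lhs_nonneg by (intro sum_mono2) auto
    also have "\<dots> \<le> C * w y"
      using lhs parts sum_nonpos[of A "\<lambda>x. H (x - y) * lap w x"] rhs_nonpos by simp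
    finally have "(\<Sum>x\<in>D - {y}. w x) * (\<theta> / \<sigma> ^ ?d) \<le> C * w y"
      by (simp only: sum_distrib_right)
    then have "(\<Sum>x\<in>D - {y}. w x) \<le> C / \<theta> * \<sigma> ^ ?d * w y"
      using B \<sigma> by (simp add: field_simps)
    moreover have "w y \<le> \<sigma> ^ ?d * w y" using wy \<sigma> by (intro mult_le_cancel_right1[THEN iffD2]) auto
    ultimately have 1: "(\<Sum>x\<in>D. w x) \<le> (C / \<theta> + 1) * \<sigma> ^ ?d * w y"
      using D by (simp add: sum.remove algebra_simps)
    have 2: "- lap w z * \<sigma>\<^sup>2 \<le> (C / \<theta> + 1) * \<sigma> ^ ?d * w y" if z: "len (z - y) \<le> \<sigma>" for z
    proof -
      have zA: "z \<in> A" using z D by (auto simp: D_def)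
      have "- C * w y \<le> (\<Sum>x\<in>A. w x * lap H (x - y))"
        using lhs sum_nonneg[of "A - {y}" "\<lambda>x. w x * lap H (x - y)"] lhs_nonneg by fastforce
      also have "\<dots> \<le> H (z - y) * lap w z"
      proof -
        have "(\<Sum>x\<in>A. H (x - y) * lap w x) = H (z - y) * lap w z + (\<Sum>x\<in>A - {z}. H (x - y) * lap w x)"
          using A zA by (simp add: sum.remove)
        moreover have "(\<Sum>x\<in>A - {z}. H (x - y) * lap w x) \<le> 0"
          by (intro sum_nonpos rhs_nonpos)
        ultimately show ?thesis using parts by simp
      qed
      finally have a: "- C * w y \<le> H (z - y) * lap w z" .
      show ?thesis
      proof (cases "len (z - y) < B * \<sigma>")
        case True
        have "H (z - y) * lap w z \<le> \<theta> * (\<sigma>\<^sup>2 / \<sigma> ^ ?d) * lap w z"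
          using H(6)[OF z] lw[OF True] by (intro mult_right_mono_neg) auto
        with a have "\<theta> * (\<sigma>\<^sup>2 / \<sigma> ^ ?d) * (- lap w z) \<le> C * w y" by simp
        then have "- lap w z * \<sigma>\<^sup>2 \<le> C / \<theta> * \<sigma> ^ ?d * w y"
          using B \<sigma> by (simp add: field_simps)
        then show ?thesis using \<open>w y \<le> \<sigma> ^ ?d * w y\<close> wy by (simp add: algebra_simps)
      next
        case False
        then have "H (z - y) = 0" using H(2) by simp
        moreover have "\<theta> * (\<sigma>\<^sup>2 / \<sigma> ^ ?d) > 0" using B \<sigma> by simp
        ultimately show ?thesis using H(6)[OF z] by simp
      qed
    qed
    show ?thesis using 1 2 by (simp add: D_def)
  qed
  then show ?thesis using that[of B "C / \<theta> + 1"] B by (simp add: add_pos_pos)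
qed

text \<open>A cube with corner \<open>y\<close> and \<open>k + 1\<close> sites per edge, where
  \<open>k\<close> is the integer part of \<open>\<sigma> / d\<close>, lies in the ball because even
  its \<open>l1\<close> radius is at most \<open>k * d\<close>.\<close>

lemma card_ball_ge:
  fixes y :: "int ^ 'd::finite"
  assumes "\<sigma> \<ge> 0"
  shows "(\<sigma> / real CARD('d)) ^ CARD('d) \<le> real (card {x. len (x - y) \<le> \<sigma>})"
proof -
  let ?d = "CARD('d)"
  define k where "k = \<lfloor>\<sigma> / real ?d\<rfloor>"
  have k: "k \<ge> 0" "real_of_int k * real ?d \<le> \<sigma>" "\<sigma> / real ?d \<le> real_of_int (k + 1)"
  proof -
    show "k \<ge> 0" using assms by (simp add: k_def)
    have "real_of_int k \<le> \<sigma> / real ?d" by (simp add: k_def)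
    then show "real_of_int k * real ?d \<le> \<sigma>" by (simp add: pos_le_divide_eq)
    show "\<sigma> / real ?d \<le> real_of_int (k + 1)" unfolding k_def by linarith
  qed
  define X where "X = (\<lambda>f :: 'd \<Rightarrow> int. (\<chi> i. f i) + y) ` (UNIV \<rightarrow>\<^sub>E {0..k})"
  have "card X = card (UNIV \<rightarrow>\<^sub>E {0..k} :: ('d \<Rightarrow> int) set)"
    unfolding X_def by (rule card_image) (auto simp: inj_on_def vec_eq_iff)
  also have "\<dots> = nat (k + 1) ^ ?d" by (simp add: card_PiE)
  finally have card: "card X = nat (k + 1) ^ ?d" .
  have "X \<subseteq> {x. len (x - y) \<le> \<sigma>}"
  proof
    fix x assume "x \<in> X"
    then obtain f where f: "f \<in> UNIV \<rightarrow>\<^sub>E {0..k}" "x = (\<chi> i. f i) + y" by (auto simp: X_def)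
    have "len (x - y) \<le> (\<Sum>i\<in>UNIV. \<bar>real_of_int ((x - y) $ i)\<bar>)"
      using len_le_l1[of "x - y"] by (simp only: real_l1)
    also have "\<dots> \<le> (\<Sum>i\<in>(UNIV :: 'd set). real_of_int k)"
      using f by (intro sum_mono) (auto simp: PiE_def Pi_def)
    also have "\<dots> \<le> \<sigma>" using k by (simp add: mult.commute)
    finally show "x \<in> {x. len (x - y) \<le> \<sigma>}" by simp
  qed
  then have "card X \<le> card {x. len (x - y) \<le> \<sigma>}"
    by (intro card_mono finite_len_le)
  moreover have "(\<sigma> / real ?d) ^ ?d \<le> real_of_int (k + 1) ^ ?d"
    using k assms by (intro power_mono) auto
  moreover have "real (card X) = real_of_int (k + 1) ^ ?d" using k by (simp add: card)
  ultimately show ?thesis by linarith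
qed

text \<open>Let \<open>y\<close> maximise \<open>(\<rho> - |x - z|)\<^sup>d u x\<close> over the ball. On a ball around \<open>y\<close> of radius comparable
  to \<open>\<rho> - |y - z|\<close> the value \<open>u y\<close> is almost the maximum of \<open>u\<close>, and the weak Harnack inequality for
  \<open>(1 + \<eta>) u y - u\<close> shows that \<open>u\<close> is comparable to \<open>u y\<close> on average there.\<close>

lemma sub_mean_value:
  assumes "CARD('d::finite) \<ge> 2"
  obtains C :: real where "C > 0"
    "\<And>\<rho> z (u :: int ^ 'd \<Rightarrow> real). \<rho> > 0 \<Longrightarrow> (\<And>x. u x \<ge> 0) \<Longrightarrow>
      (\<And>x. len (x - z) < \<rho> \<Longrightarrow> lap u x \<ge> 0) \<Longrightarrow>
      \<rho> ^ CARD('d) * u z \<le> C * (\<Sum>x | len (x - z) < \<rho>. u x)"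
proof -
  let ?d = "CARD('d)"
  obtain B W :: real where B: "B \<ge> 1" "W > 0" and harnack:
    "\<And>\<sigma> y (w :: int ^ 'd \<Rightarrow> real).
      \<sigma> \<ge> 1 \<Longrightarrow> (\<And>x. len (x - y) \<le> B * \<sigma> + 1 \<Longrightarrow> w x \<ge> 0) \<Longrightarrow>
      (\<And>x. len (x - y) < B * \<sigma> \<Longrightarrow> lap w x \<le> 0) \<Longrightarrow>
      (\<Sum>x | len (x - y) \<le> \<sigma>. w x) \<le> W * \<sigma> ^ ?d * w y \<and>
      (\<forall>z. len (z - y) \<le> \<sigma> \<longrightarrow> - lap w z * \<sigma>\<^sup>2 \<le> W * \<sigma> ^ ?d * w y)"
    by (rule weak_harnack[OF assms]) blast
  define c :: real where "c = (1 / real ?d) ^ ?d"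
  have c: "c > 0" by (simp add: c_def)
  \<comment> \<open>The Harnack bound for the deficit is then at most half of what the constant
    \<open>u y\<close> would sum to, so \<open>u\<close> retains the other half.\<close>
  define \<eta> where "\<eta> = c / (2 * W)"
  have \<eta>: "\<eta> > 0" "W * \<eta> = c / 2" using c B by (auto simp: \<eta>_def)
  \<comment> \<open>Chosen so that Bernoulli's inequality bounds the change of the weight over a
    ball of radius \<open>\<epsilon> * \<tau>\<close> by the factor
    \<open>1 + \<eta>\<close>.\<close>
  define \<epsilon> where "\<epsilon> = \<eta> / (real ?d * (1 + \<eta>))"
  have \<epsilon>0: "\<epsilon> > 0" using \<eta> by (simp add: \<epsilon>_def)
  have \<epsilon>d: "real ?d * \<epsilon> = \<eta> / (1 + \<eta>)" by (simp add: \<epsilon>_def)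
  have "real ?d * \<epsilon> < 1" unfolding \<epsilon>d using \<eta> by simp
  moreover have "1 * \<epsilon> \<le> real ?d * \<epsilon>" using assms \<epsilon>0 by (intro mult_right_mono) auto
  ultimately have \<epsilon>1: "\<epsilon> < 1" by simp
  have bern: "1 / (1 + \<eta>) \<le> (1 - \<epsilon>) ^ ?d"
  proof -
    have "1 + real ?d * (- \<epsilon>) \<le> (1 + (- \<epsilon>)) ^ ?d"
      using \<epsilon>1 by (intro Bernoulli_inequality) auto
    moreover have "1 + real ?d * (- \<epsilon>) = 1 / (1 + \<eta>)" using \<epsilon>d \<eta> by (simp add: field_simps)
    ultimately show ?thesis by simp
  qed
  define K where "K = ((B + 1) / \<epsilon>) ^ ?d"
  have K: "K > 0" using B \<epsilon>0 by (simp add: K_def)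
  define C where "C = K * (1 + 2 / c)"
  have C: "C > 0" using K c by (simp add: C_def add_pos_pos)
  have "\<rho> ^ ?d * u z \<le> C * (\<Sum>x | len (x - z) < \<rho>. u x)"
    if \<rho>: "\<rho> > 0" and u: "\<And>x. u x \<ge> 0" and sub: "\<And>x. len (x - z) < \<rho> \<Longrightarrow> lap u x \<ge> 0"
    for \<rho> z and u :: "int ^ 'd \<Rightarrow> real"
  proof -
    define A where "A = {x. len (x - z) < \<rho>}"
    have A: "finite A" "z \<in> A" using finite_len_less \<rho> by (auto simp: A_def len_0)
    define g where "g = (\<lambda>x. (\<rho> - len (x - z)) ^ ?d * u x)"
    have "finite (g ` A)" "g ` A \<noteq> {}" using A by auto
    then have "Max (g ` A) \<in> g ` A" by (rule Max_in)
    then obtain y where y: "y \<in> A" "g y = Max (g ` A)" by auto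
    have gmax: "g x \<le> g y" if "x \<in> A" for x using A that y by simp
    define U \<tau> where "U = u y" and "\<tau> = \<rho> - len (y - z)"
    have U: "U \<ge> 0" using u by (simp add: U_def)
    have \<tau>: "\<tau> > 0" using y by (simp add: \<tau>_def A_def)
    have gy: "g y = \<tau> ^ ?d * U" by (simp add: g_def U_def \<tau>_def)
    have gz: "\<rho> ^ ?d * u z \<le> \<tau> ^ ?d * U" using gmax[OF A(2)] gy by (simp add: g_def len_0)
    have near: "len (x - z) < \<rho>" if "len (x - y) < \<tau>" for x
      using len_diff_triangle[of x z y] that by (simp add: \<tau>_def)
    have almost_max: "u x \<le> (1 + \<eta>) * U" if "len (x - y) \<le> \<epsilon> * \<tau>" for x
    proof -
      have "\<epsilon> * \<tau> < \<tau>" using \<epsilon>1 \<tau> by simp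
      then have xA: "x \<in> A" using near[of x] that by (simp add: A_def)
      have "(1 - \<epsilon>) * \<tau> \<le> \<rho> - len (x - z)"
        using len_diff_triangle[of x z y] that by (simp add: \<tau>_def algebra_simps)
      then have "((1 - \<epsilon>) * \<tau>) ^ ?d * u x \<le> (\<rho> - len (x - z)) ^ ?d * u x"
        using \<epsilon>1 \<tau> u by (intro mult_right_mono power_mono) auto
      also have "\<dots> \<le> \<tau> ^ ?d * U" using gmax[OF xA] gy by (simp add: g_def)
      finally have "\<tau> ^ ?d * ((1 - \<epsilon>) ^ ?d * u x) \<le> \<tau> ^ ?d * U"
        by (simp add: power_mult_distrib mult_ac)
      then have "(1 - \<epsilon>) ^ ?d * u x \<le> U" using \<tau> by simp
      moreover have "1 / (1 + \<eta>) * u x \<le> (1 - \<epsilon>) ^ ?d * u x"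
        using bern u by (intro mult_right_mono) auto
      ultimately have "u x / (1 + \<eta>) \<le> U" by simp
      then show ?thesis using \<eta> by (simp add: field_simps)
    qed
    have "\<tau> ^ ?d * U \<le> C * (\<Sum>x\<in>A. u x)"
    \<comment> \<open>When \<tau> is bounded by a constant there is no room for a Harnack ball of
      radius at least \<open>1\<close>; the single summand \<open>u y\<close> is then
      enough.\<close>
    proof (cases "\<epsilon> * \<tau> < B + 1")
      case True
      then have "\<tau> \<le> (B + 1) / \<epsilon>" using \<epsilon>0 by (simp add: field_simps)
      then have "\<tau> ^ ?d * U \<le> K * U"
        unfolding K_def using \<tau> U by (intro mult_right_mono power_mono) auto
      also have "\<dots> \<le> C * U"
        unfolding C_def using K U c by (intro mult_right_mono) auto
      also have "U \<le> (\<Sum>x\<in>A. u x)"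
        unfolding U_def using A y u by (intro member_le_sum) auto
      finally show ?thesis using C by simp
    next
      case False
      define \<sigma> where "\<sigma> = (\<epsilon> * \<tau> - 1) / B"
      have \<sigma>: "\<sigma> \<ge> 1" "B * \<sigma> + 1 = \<epsilon> * \<tau>" using False B by (auto simp: \<sigma>_def field_simps)
      have "1 * \<sigma> \<le> B * \<sigma>" using B \<sigma> by (intro mult_right_mono) auto
      moreover have "\<epsilon> * \<tau> < \<tau>" using \<epsilon>1 \<tau> by simp
      ultimately have \<sigma>\<tau>: "\<sigma> < \<tau>" "B * \<sigma> < \<tau>" using \<sigma>(2) by linarith+
      define w where "w = (\<lambda>x. (1 + \<eta>) * U - u x)"
      define D where "D = {x. len (x - y) \<le> \<sigma>}"
      have "(\<Sum>x | len (x - y) \<le> \<sigma>. w x) \<le> W * \<sigma> ^ ?d * w y"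
      proof (rule harnack[THEN conjunct1, OF \<sigma>(1)])
        fix x assume "len (x - y) \<le> B * \<sigma> + 1"
        then show "w x \<ge> 0" using almost_max[of x] by (simp add: \<sigma>(2) w_def)
      next
        fix x assume "len (x - y) < B * \<sigma>"
        then have "len (x - z) < \<rho>" using \<sigma>\<tau> by (intro near) auto
        then have "lap u x \<ge> 0" by (rule sub)
        then show "lap w x \<le> 0" unfolding w_def lap_diff lap_const by simp
      qed
      also have "w y = \<eta> * U" by (simp add: w_def U_def algebra_simps)
      also have "W * \<sigma> ^ ?d * (\<eta> * U) = W * \<eta> * (\<sigma> ^ ?d * U)" by simp
      also have "\<dots> = c / 2 * (\<sigma> ^ ?d * U)" by (simp only: \<eta>(2))
      finally have 1: "(\<Sum>x\<in>D. w x) \<le> c / 2 * (\<sigma> ^ ?d * U)" by (simp add: D_def)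
      have "(\<Sum>x\<in>D. w x) = real (card D) * ((1 + \<eta>) * U) - (\<Sum>x\<in>D. u x)"
        by (simp add: w_def sum_subtractf)
      moreover have "c * \<sigma> ^ ?d * U \<le> real (card D) * ((1 + \<eta>) * U)"
      proof (intro mult_mono)
        show "c * \<sigma> ^ ?d \<le> real (card D)"
          using card_ball_ge[of \<sigma> y] \<sigma> by (simp add: c_def D_def power_divide)
        show "U \<le> (1 + \<eta>) * U" using \<eta> U by (simp add: algebra_simps)
      qed (use U in auto)
      ultimately have "c / 2 * (\<sigma> ^ ?d * U) \<le> (\<Sum>x\<in>D. u x)" using 1 by simp
      also have "\<dots> \<le> (\<Sum>x\<in>A. u x)"
      proof (rule sum_mono2[OF A(1)])
        show "D \<subseteq> A" using near \<sigma>\<tau> by (fastforce simp: D_def A_def)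
      qed (use u in auto)
      finally have 2: "\<sigma> ^ ?d * U \<le> 2 / c * (\<Sum>x\<in>A. u x)" using c by (simp add: field_simps)
      have "\<epsilon> * \<tau> \<le> (B + 1) * \<sigma>" using \<sigma> by (simp add: algebra_simps)
      then have "\<tau> \<le> (B + 1) / \<epsilon> * \<sigma>" using \<epsilon>0 by (simp add: field_simps)
      then have "\<tau> ^ ?d * U \<le> ((B + 1) / \<epsilon> * \<sigma>) ^ ?d * U"
        using \<tau> U by (intro mult_right_mono power_mono) auto
      also have "\<dots> = K * (\<sigma> ^ ?d * U)" by (simp only: K_def power_mult_distrib mult.assoc)
      also have "\<dots> \<le> K * (2 / c * (\<Sum>x\<in>A. u x))" using 2 K by (intro mult_left_mono) auto
      also have "\<dots> \<le> C * (\<Sum>x\<in>A. u x)"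
        using K u by (simp add: C_def algebra_simps sum_nonneg)
      finally show ?thesis .
    qed
    with gz show ?thesis by (simp add: A_def)
  qed
  then show ?thesis using that[of C] C by blast
qed

section \<open>The limit odometer\<close>

text \<open>This is the change of mass caused by toppling excess \<open>e\<close> at
  \<open>z\<close>.\<close>

lemma lap_point:
  fixes z y :: "int ^ 'd::finite"
  shows "lap (\<lambda>x. if x = z then e else 0) y
    = (if z \<sim> y then e / (2 * real CARD('d)) else 0) - (if y = z then e else 0)"
proof -
  let ?N = "\<Sum>i\<in>UNIV. (if y + axis i 1 = z then e else 0) + (if y - axis i 1 = z then e else 0)"
  have "?N = (if z \<sim> y then e else 0)"
  proof (cases "z \<sim> y")
    case True
    then obtain i where i: "z = y + axis i 1 \<or> z = y - axis i 1"
      using adj_sym[of z y] adj_iff[of y z] by blast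
    have plus: "y + axis j 1 = y + axis i 1 \<longleftrightarrow> j = i" and minus: "y - axis j 1 = y - axis i 1 \<longleftrightarrow> j = i" for j
      by (auto simp: axis_eq_axis)
    have "(y + axis j 1) $ j \<noteq> (y - axis i 1) $ j" "(y - axis j 1) $ j \<noteq> (y + axis i 1) $ j" for j
      by (auto simp: axis_def)
    then have cross: "y + axis j 1 \<noteq> y - axis i 1" "y - axis j 1 \<noteq> y + axis i 1" for j
      by metis+
    have "?N = (\<Sum>j\<in>UNIV. if j = i then e else 0)"
      using i by (intro sum.cong) (auto simp: plus minus cross axis_eq_axis)
    then show ?thesis using True by simp
  next
    case False
    then have "y + axis i 1 \<noteq> z" "y - axis i 1 \<noteq> z" for i
      using adj_sym[of z y] adj_iff[of y z] by blast+
    then show ?thesis using False by simp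
  qed
  then show ?thesis by (simp add: lap_def)
qed

lemma finite_with_neighbours:
  fixes F :: "(int ^ 'd::finite) set"
  assumes "finite F"
  obtains A where "finite A" "F \<subseteq> A" "\<And>x i. x \<in> F \<Longrightarrow> x + axis i 1 \<in> A \<and> x - axis i 1 \<in> A"
proof
  show "finite (F \<union> (\<Union>i. (\<lambda>x. x + axis i 1) ` F) \<union> (\<Union>i. (\<lambda>x. x - axis i 1) ` F))"
    using assms by auto
qed auto

text \<open>\<open>K\<close> and \<open>\<theta>\<close> are parameters since constants defined in the locale could not depend on the
  dimension through \<^typ>\<open>'d itself\<close> alone.\<close>

locale sandpile_run =
  fixes n m K \<theta> :: real and T :: "nat \<Rightarrow> int ^ 'd::finite"
  assumes m_pos: "m > 0" and n_pos: "n > 0" and infinitive: "infinitive T"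
    and dim: "CARD('d) \<ge> 2"
    and K_def: "K = odometer_bound TYPE('d) n m"
    and \<theta>_def: "\<theta> = min m (K / (2 * real CARD('d)))"
begin

section \<open>Invariants of a finite run\<close>

abbreviation S :: "nat \<Rightarrow> 'd sandpile" where "S k \<equiv> sandpile_at n m T k"
abbreviation \<mu> :: "nat \<Rightarrow> int ^ 'd \<Rightarrow> real" where "\<mu> k \<equiv> mass (S k)"
abbreviation u :: "nat \<Rightarrow> int ^ 'd \<Rightarrow> real" where "u k \<equiv> odometer (S k)"
abbreviation v :: "int ^ 'd \<Rightarrow> real" where "v \<equiv> limit_odometer n m T"

lemma K_pos: "K > 0"
  using m_pos n_pos by (simp add: K_def odometer_bound_def)

lemma excess_pos: "unstable n m R x \<Longrightarrow> excess m R x > 0"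
  using m_pos by (auto simp: unstable_def excess_def)

lemma odometer_Suc:
  "u (Suc k) x = u k x + (if x = T k then if unstable n m (S k) (T k) then excess m (S k) (T k) else 0 else 0)"
  by (simp add: topple_def)

lemma odometer_mono: "u k x \<le> u (Suc k) x"
  using excess_pos[of "S k" "T k"] by (auto simp: odometer_Suc simp del: sandpile_at.simps)

lemma odometer_nonneg: "u k x \<ge> 0"
proof (induction k)
  case 0
  show ?case by (simp add: initial_def)
next
  case (Suc k)
  then show ?case using odometer_mono[of k x] by linarith
qed

text \<open>The odometer determines the mass, so convergence of odometers carries over to
  masses.\<close>

lemma mass_eq: "\<mu> k x = (if x = 0 then n else 0) + lap (u k) x"
proof (induction k arbitrary: x)
  case 0
  show ?case by (simp add: initial_def lap_const)
next
  case (Suc k)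
  show ?case
  proof (cases "unstable n m (S k) (T k)")
    case True
    let ?e = "excess m (S k) (T k)"
    have "u (Suc k) = (\<lambda>x. u k x + (if x = T k then ?e else 0))"
      using True by (auto simp: odometer_Suc simp del: sandpile_at.simps)
    then have "lap (u (Suc k)) x = lap (u k) x
      + ((if T k \<sim> x then ?e / (2 * real CARD('d)) else 0) - (if x = T k then ?e else 0))"
      by (simp only: lap_add lap_point)
    moreover have "\<not> T k \<sim> T k" by (simp add: adj_def)
    then have "\<mu> (Suc k) x = \<mu> k x
      + ((if T k \<sim> x then ?e / (2 * real CARD('d)) else 0) - (if x = T k then ?e else 0))"
      using True by (auto simp: topple_def)
    ultimately show ?thesis using Suc.IH[of x] by (simp del: sandpile_at.simps)
  next
    case False
    then show ?thesis using Suc.IH[of x] by (simp add: topple_def)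
  qed
qed

lemma mass_nonneg: "\<mu> k x \<ge> 0"
proof (induction k arbitrary: x)
  case 0
  show ?case using n_pos by (simp add: initial_def)
next
  case (Suc k)
  then show ?case
    using m_pos excess_pos[of "S k" "T k"]
    by (auto simp: topple_def excess_def unstable_def add_nonneg_nonneg)
qed

text \<open>Expresses visits through the odometer: a site with a neighbour that is never visited has
  never toppled.\<close>

lemma visited_eq: "visited (S k) = {0} \<union> {y. \<exists>x. u k x > 0 \<and> x \<sim> y}"
proof (induction k)
  case 0
  show ?case by (simp add: initial_def)
next
  case (Suc k)
  show ?case
  proof (cases "unstable n m (S k) (T k)")
    case True
    have "u (Suc k) x > 0 \<longleftrightarrow> u k x > 0 \<or> x = T k" for x
      using True excess_pos[OF True] odometer_nonneg[of k x]
      by (auto simp: odometer_Suc add_nonneg_pos simp del: sandpile_at.simps)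
    then have "{y. \<exists>x. u (Suc k) x > 0 \<and> x \<sim> y} = {y. \<exists>x. u k x > 0 \<and> x \<sim> y} \<union> {y. T k \<sim> y}"
      by blast
    moreover have "visited (S (Suc k)) = visited (S k) \<union> {y. T k \<sim> y}"
      using True by (simp add: topple_def)
    ultimately show ?thesis using Suc by blast
  next
    case False
    then show ?thesis using Suc by (simp add: topple_def)
  qed
qed

text \<open>A toppling that empties a site needs an odometer already above \<open>K\<close>. While
  the odometer is at most \<open>K\<close>, every toppling at the site leaves exactly
  \<open>m\<close>, and topplings elsewhere only add mass.\<close>

lemma mass_ge_threshold: "0 < u k x \<Longrightarrow> u k x \<le> K \<Longrightarrow> \<mu> k x \<ge> m"
proof (induction k arbitrary: x)
  case 0
  then show ?case by (simp add: initial_def)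
next
  case (Suc k)
  show ?case
  proof (cases "unstable n m (S k) (T k)")
    case True
    show ?thesis
    proof (cases "x = T k")
      case x: True
      have "u (Suc k) x = u k x + excess m (S k) x" using True x by (simp add: topple_def)
      then have "u k x < K" using Suc.prems(2) True excess_pos[OF True] by (simp add: x)
      then have "\<mu> k x > m" using True x by (auto simp: unstable_def K_def)
      then show ?thesis using True x by (simp add: topple_def excess_def)
    next
      case False
      then have "u (Suc k) x = u k x" by (simp add: topple_def)
      then have "\<mu> k x \<ge> m" using Suc by simp
      moreover have "\<mu> k x \<le> \<mu> (Suc k) x"
        using True False less_imp_le[OF excess_pos[OF True]] by (simp add: topple_def)
      ultimately show ?thesis by linarith
    qed
  next
    case False
    then show ?thesis using Suc by (simp add: topple_def)
  qed
qed

lemma finite_support: "finite {x. u k x \<noteq> 0}"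
proof (induction k)
  case 0
  show ?case by (simp add: initial_def)
next
  case (Suc k)
  have "{x. u (Suc k) x \<noteq> 0} \<subseteq> insert (T k) {x. u k x \<noteq> 0}"
    by (auto simp: odometer_Suc simp del: sandpile_at.simps split: if_splits)
  then show ?case using Suc finite_subset by blast
qed

lemma neighbour_of_toppled:
  assumes "\<mu> k x > 0" "u k x = 0" "x \<noteq> 0"
  obtains i y where "y = x + axis i 1 \<or> y = x - axis i 1" "u k y > 0"
proof -
  have "lap (u k) x > 0" using assms mass_eq[of k x] by simp
  then show ?thesis using ex_larger_neighbour assms(2) that by metis
qed

section \<open>Confinement of the toppled sites\<close>

lemma coord_neighbour:
  assumes "y = x + axis i 1 \<or> y = x - axis i (1::int)"
  shows "\<bar>x $ j\<bar> \<le> \<bar>y $ j\<bar> + 1"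
  using assms by (auto simp: axis_def)

text \<open>A site other than the origin that topples for the first time has a neighbour that
  toppled before, and \<open>|x $ i|\<close> changes by at most \<open>1\<close> between them; no
  layer is skipped.\<close>

lemma toppled_hyperplanes:
  "u k x > 0 \<Longrightarrow> j \<le> nat \<bar>x $ i\<bar> \<Longrightarrow> \<exists>y. u k y > 0 \<and> nat \<bar>y $ i\<bar> = j"
proof (induction k arbitrary: x j)
  case 0
  then show ?case by (simp add: initial_def)
next
  case (Suc k)
  have mono: "u k y > 0 \<Longrightarrow> u (Suc k) y > 0" for y using odometer_mono[of k y] by linarith
  show ?case
  proof (cases "u k x > 0")
    case True
    then show ?thesis using Suc mono by blast
  next
    case False
    then have ux: "u k x = 0" using odometer_nonneg[of k x] by linarith
    then have x: "x = T k" "unstable n m (S k) (T k)"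
      using Suc.prems(1) by (auto simp: odometer_Suc simp del: sandpile_at.simps split: if_splits)
    then have mass: "\<mu> k x > 0" using m_pos by (auto simp: unstable_def)
    show ?thesis
    proof (cases "j = nat \<bar>x $ i\<bar>")
      case True
      then show ?thesis using Suc.prems by blast
    next
      case False
      then have "x \<noteq> 0" using Suc.prems by auto
      then obtain l y where y: "y = x + axis l 1 \<or> y = x - axis l 1" "u k y > 0"
        using neighbour_of_toppled mass ux by blast
      have "j \<le> nat \<bar>y $ i\<bar>" using coord_neighbour[OF y(1), of i] Suc.prems(2) False by linarith
      then show ?thesis using Suc.IH[OF y(2)] mono by blast
    qed
  qed
qed

text \<open>Used with \<open>f = 1\<close> for conservation of mass and with \<open>f = sqn\<close>
  for the second moment.\<close>

lemma sum_mass: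
  assumes "finite A" "0 \<in> A"
    "\<And>x. u k x \<noteq> 0 \<Longrightarrow> x \<in> A \<and> (\<forall>i. x + axis i 1 \<in> A \<and> x - axis i 1 \<in> A)"
  shows "(\<Sum>x\<in>A. f x * \<mu> k x) = f 0 * n + (\<Sum>x\<in>A. u k x * lap f x)"
proof -
  have "(\<Sum>x\<in>A. f x * \<mu> k x) = (\<Sum>x\<in>A. if x = 0 then f 0 * n else 0) + (\<Sum>x\<in>A. f x * lap (u k) x)"
    unfolding sum.distrib[symmetric] by (intro sum.cong) (auto simp: mass_eq distrib_left)
  also have "(\<Sum>x\<in>A. f x * lap (u k) x) = (\<Sum>x\<in>A. u k x * lap f x)"
    by (rule sum_by_parts) (use assms in auto)
  finally show ?thesis using assms by simp
qed

lemma \<theta>_pos: "\<theta> > 0"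
  using m_pos K_pos by (simp add: \<theta>_def)

text \<open>Every hyperplane \<open>|x\<^sub>i| = j\<close> that meets the toppled set carries a site of mass at least \<open>\<theta>\<close>: an
  extremal toppled site in another coordinate direction, or the untoppled site next to it.\<close>

lemma heavy_site:
  assumes "u k x > 0" "j \<le> nat \<bar>x $ i\<bar>"
  obtains s where "nat \<bar>s $ i\<bar> = j" "\<mu> k s \<ge> \<theta>"
proof -
  have "\<exists>l. l \<noteq> i"
  proof (rule ccontr)
    assume "\<not> ?thesis"
    then have "(UNIV :: 'd set) = {i}" by auto
    then have "CARD('d) = 1" by (metis card.empty card.insert empty_iff finite.emptyI One_nat_def)
    then show False using dim by simp
  qed
  then obtain l where l: "l \<noteq> i" by blast
  define P where "P = {y. u k y > 0 \<and> nat \<bar>y $ i\<bar> = j}"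
  have P: "finite P" "P \<noteq> {}"
  proof -
    have "P \<subseteq> {x. u k x \<noteq> 0}" by (auto simp: P_def)
    then show "finite P" using finite_support finite_subset by blast
    show "P \<noteq> {}" using toppled_hyperplanes[OF assms] by (auto simp: P_def)
  qed
  then have "Max ((\<lambda>y. y $ l) ` P) \<in> (\<lambda>y. y $ l) ` P" by (intro Max_in) auto
  then obtain y where y: "y \<in> P" "y $ l = Max ((\<lambda>y. y $ l) ` P)" by auto
  have ymax: "z $ l \<le> y $ l" if "z \<in> P" for z using P that y by simp
  show ?thesis
  proof (cases "u k y \<le> K")
    case True
    then have "\<mu> k y \<ge> \<theta>" using mass_ge_threshold[of k y] y(1) by (simp add: P_def \<theta>_def)
    then show ?thesis using that[of y] y(1) by (simp add: P_def)
  next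
    case False
    \<comment> \<open>\<open>y\<close> may have been emptied, but \<open>z\<close> lies in the same
      hyperplane beyond the extremal toppled site, so it has kept its share of what \<open>y\<close>
      sent out, more than \<open>K / (2 * d)\<close>.\<close>
    define z where "z = y + axis l 1"
    have zi: "z $ i = y $ i" and zl: "z $ l = y $ l + 1" using l by (auto simp: z_def axis_def)
    have "z \<notin> P" using ymax[of z] zl by auto
    then have uz: "u k z = 0" using y(1) zi odometer_nonneg[of k z] by (auto simp: P_def)
    have "lap (u k) z \<ge> u k y / (2 * real CARD('d)) - u k z"
      by (rule lap_ge_single[where j = l]) (auto simp: odometer_nonneg z_def)
    moreover have "\<mu> k z \<ge> lap (u k) z" using mass_eq[of k z] n_pos by simp
    moreover have "K / (2 * real CARD('d)) \<le> u k y / (2 * real CARD('d))"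
      using False by (intro divide_right_mono) auto
    ultimately have "\<mu> k z \<ge> \<theta>" using uz by (simp add: \<theta>_def)
    then show ?thesis using that[of z] zi y(1) by (simp add: P_def)
  qed
qed

text \<open>Heavy sites in different layers are distinct and the total mass is \<open>n\<close>, so
  there are at most \<open>n / \<theta>\<close> layers. The bound is crude but independent of
  \<open>k\<close>.\<close>

lemma toppled_bounded:
  assumes "u k x > 0"
  shows "real_of_int \<bar>x $ i\<bar> \<le> n / \<theta>"
proof -
  let ?M = "nat \<bar>x $ i\<bar>"
  have "\<forall>j\<le>?M. \<exists>s. nat \<bar>s $ i\<bar> = j \<and> \<mu> k s \<ge> \<theta>"
    using heavy_site[OF assms] by metis
  then obtain s where s: "\<And>j. j \<le> ?M \<Longrightarrow> nat \<bar>s j $ i\<bar> = j" "\<And>j. j \<le> ?M \<Longrightarrow> \<mu> k (s j) \<ge> \<theta>"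
    by metis
  have "finite ({x. u k x \<noteq> 0} \<union> {0} \<union> s ` {..?M})" using finite_support by simp
  then obtain A where A: "finite A" "{x. u k x \<noteq> 0} \<union> {0} \<union> s ` {..?M} \<subseteq> A"
    "\<And>x i. x \<in> {x. u k x \<noteq> 0} \<union> {0} \<union> s ` {..?M} \<Longrightarrow> x + axis i 1 \<in> A \<and> x - axis i 1 \<in> A"
    by (rule finite_with_neighbours) blast
  have "(\<Sum>x\<in>A. 1 * \<mu> k x) = 1 * n + (\<Sum>x\<in>A. u k x * lap (\<lambda>x. 1) x)"
    by (rule sum_mass) (use A in auto)
  then have total: "(\<Sum>x\<in>A. \<mu> k x) = n" by (simp add: lap_const)
  have "inj_on s {..?M}" by (intro inj_onI) (metis atMost_iff s(1))
  then have "(\<Sum>j\<le>?M. \<mu> k (s j)) = (\<Sum>x\<in>s ` {..?M}. \<mu> k x)" by (simp add: sum.reindex)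
  also have "\<dots> \<le> (\<Sum>x\<in>A. \<mu> k x)" using A mass_nonneg by (intro sum_mono2) auto
  also have "\<dots> = n" by (rule total)
  finally have "(\<Sum>j\<le>?M. \<theta>) \<le> n" using sum_mono[of "{..?M}" "\<lambda>j. \<theta>" "\<lambda>j. \<mu> k (s j)"] s(2) by fastforce
  then have "(real ?M + 1) * \<theta> \<le> n" by (simp add: add.commute)
  then have "real ?M + 1 \<le> n / \<theta>" using \<theta>_pos by (simp add: pos_le_divide_eq)
  then show ?thesis by simp
qed

text \<open>As \<open>lap sqn = 1\<close>, the second moment of the mass equals the sum of the
  odometer; it is bounded because mass sits at the origin, on toppled sites or next to them.\<close>

lemma odometer_bounded: "u k x \<le> real CARD('d) * (n / \<theta> + 1)\<^sup>2 * n"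
proof -
  define Q where "Q = real CARD('d) * (n / \<theta> + 1)\<^sup>2"
  have "finite ({x. u k x \<noteq> 0} \<union> {0, x})" using finite_support by simp
  then obtain A where A: "finite A" "{x. u k x \<noteq> 0} \<union> {0, x} \<subseteq> A"
    "\<And>y i. y \<in> {x. u k x \<noteq> 0} \<union> {0, x} \<Longrightarrow> y + axis i 1 \<in> A \<and> y - axis i 1 \<in> A"
    by (rule finite_with_neighbours) blast
  have "(\<Sum>x\<in>A. 1 * \<mu> k x) = 1 * n + (\<Sum>x\<in>A. u k x * lap (\<lambda>x. 1) x)"
    by (rule sum_mass) (use A in auto)
  then have total: "(\<Sum>x\<in>A. \<mu> k x) = n" by (simp add: lap_const)
  have "(\<Sum>x\<in>A. sqn x * \<mu> k x) = sqn (0 :: int ^ 'd) * n + (\<Sum>x\<in>A. u k x * lap sqn x)"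
    by (rule sum_mass) (use A in auto)
  then have second: "(\<Sum>x\<in>A. sqn x * \<mu> k x) = (\<Sum>x\<in>A. u k x)" by (simp add: lap_sqn sqn_def)
  have "sqn y * \<mu> k y \<le> Q * \<mu> k y" for y
  proof (cases "\<mu> k y > 0")
    case True
    have "real_of_int \<bar>y $ i\<bar> \<le> n / \<theta> + 1" for i
    proof -
      consider "u k y > 0" | "y = 0" | "u k y = 0" "y \<noteq> 0" using odometer_nonneg[of k y] by fastforce
      then show ?thesis
      proof cases
        case 1
        then show ?thesis using toppled_bounded[of k y i] by simp
      next
        case 2
        then show ?thesis using n_pos \<theta>_pos by (simp add: add_nonneg_nonneg)
      next
        case 3
        then obtain l z where z: "z = y + axis l 1 \<or> z = y - axis l 1" "u k z > 0"
          using neighbour_of_toppled True by blast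
        have "real_of_int \<bar>y $ i\<bar> \<le> real_of_int \<bar>z $ i\<bar> + 1"
          using coord_neighbour[OF z(1), of i] by linarith
        then show ?thesis using toppled_bounded[OF z(2), of i] by linarith
      qed
    qed
    then have "(real_of_int (y $ i))\<^sup>2 \<le> (n / \<theta> + 1)\<^sup>2" for i
      by (metis abs_ge_zero of_int_abs power2_abs power_mono)
    then have "sqn y \<le> (\<Sum>i\<in>(UNIV :: 'd set). (n / \<theta> + 1)\<^sup>2)"
      unfolding sqn_def by (intro sum_mono) auto
    then show ?thesis using True by (simp add: Q_def)
  next
    case False
    then have "\<mu> k y = 0" using mass_nonneg[of k y] by linarith
    then show ?thesis by simp
  qed
  then have "(\<Sum>x\<in>A. sqn x * \<mu> k x) \<le> Q * (\<Sum>x\<in>A. \<mu> k x)"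
    unfolding sum_distrib_left by (intro sum_mono)
  moreover have "u k x \<le> (\<Sum>x\<in>A. u k x)"
    using A odometer_nonneg by (intro member_le_sum) auto
  ultimately show ?thesis using total second by (simp add: Q_def)
qed

section \<open>Passage to the limit\<close>

lemma odometer_limit: "(\<lambda>k. u k x) \<longlonglongrightarrow> v x" and odometer_le_limit: "u k x \<le> v x"
proof -
  have "incseq (\<lambda>k. u k x)" by (rule incseq_SucI) (rule odometer_mono)
  then obtain L where L: "(\<lambda>k. u k x) \<longlonglongrightarrow> L" "\<forall>k. u k x \<le> L"
    using incseq_convergent[of "\<lambda>k. u k x"] odometer_bounded by metis
  then have "v x = L" unfolding limit_odometer_def by (intro limI)
  with L show "(\<lambda>k. u k x) \<longlonglongrightarrow> v x" "u k x \<le> v x" by auto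
qed

lemma limit_nonneg: "v x \<ge> 0"
  using odometer_le_limit[of 0 x] odometer_nonneg[of 0 x] by linarith

lemma finite_limit_support: "finite {x. v x \<noteq> 0}"
proof -
  have "{x. v x \<noteq> 0} \<subseteq> {x. \<forall>i. \<bar>x $ i\<bar> \<le> \<lceil>n / \<theta>\<rceil>}"
  proof clarify
    fix x i assume x: "v x \<noteq> 0"
    have "\<exists>k. u k x > 0"
    proof (rule ccontr)
      assume "\<nexists>k. u k x > 0"
      then have "u k x = 0" for k using odometer_nonneg[of k x] by (metis order_le_less)
      then have "v x = 0" using odometer_limit[of x] LIMSEQ_unique[OF _ tendsto_const] by simp
      with x show False ..
    qed
    then show "\<bar>x $ i\<bar> \<le> \<lceil>n / \<theta>\<rceil>" using toppled_bounded[of _ x i] by (meson le_ceiling_iff order_trans le_of_int_ceiling of_int_le_iff)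
  qed
  then show ?thesis using finite_coord_bounded finite_subset by blast
qed

abbreviation \<nu> :: "int ^ 'd \<Rightarrow> real" where "\<nu> x \<equiv> (if x = 0 then n else 0) + lap v x"

lemma mass_limit: "(\<lambda>k. \<mu> k x) \<longlonglongrightarrow> \<nu> x"
  unfolding mass_eq lap_def by (intro tendsto_intros odometer_limit) auto

lemma limit_mass_nonneg: "\<nu> x \<ge> 0"
  using LIMSEQ_le_const[OF mass_limit] mass_nonneg by blast

text \<open>If the limit mass exceeded \<open>m\<close> by \<open>2 * \<epsilon>\<close>, a late
  visit to \<open>x\<close> would add more than \<epsilon> to an odometer already within \<epsilon>
  of its limit. Such a visit exists because the sequence is infinitive.\<close>

lemma limit_mass_le: "\<nu> x \<le> m"
proof (rule ccontr)
  assume "\<not> \<nu> x \<le> m"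
  define \<epsilon> where "\<epsilon> = (\<nu> x - m) / 2"
  have \<epsilon>: "\<epsilon> > 0" "m + \<epsilon> < \<nu> x" using \<open>\<not> \<nu> x \<le> m\<close> by (simp_all add: \<epsilon>_def field_simps)
  have "\<forall>\<^sub>F k in sequentially. \<mu> k x > m + \<epsilon>"
    using order_tendstoD(1)[OF mass_limit \<epsilon>(2)] .
  moreover have "\<forall>\<^sub>F k in sequentially. u k x > v x - \<epsilon>"
    using order_tendstoD(1)[OF odometer_limit, of "v x - \<epsilon>" x] \<epsilon> by simp
  ultimately have "\<forall>\<^sub>F k in sequentially. \<mu> k x > m + \<epsilon> \<and> u k x > v x - \<epsilon>" by (rule eventually_conj)
  then obtain N where N: "\<And>k. k \<ge> N \<Longrightarrow> \<mu> k x > m + \<epsilon> \<and> u k x > v x - \<epsilon>"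
    unfolding eventually_sequentially by blast
  have "infinite {k. T k = x}" using infinitive by (simp add: infinitive_def)
  then obtain k where k: "k \<ge> N" "T k = x" unfolding infinite_nat_iff_unbounded_le by blast
  have "u (Suc k) x = u k x + (\<mu> k x - m)"
    using N[OF k(1)] k(2) \<epsilon> by (simp add: topple_def unstable_def excess_def)
  then have "u (Suc k) x > v x" using N[OF k(1)] by linarith
  then show False using odometer_le_limit[of "Suc k" x] by linarith
qed

lemma limit_mass_ge:
  assumes "0 < v x" "v x \<le> K"
  shows "\<nu> x \<ge> m"
proof -
  have "\<forall>\<^sub>F k in sequentially. u k x > 0"
    using order_tendstoD(1)[OF odometer_limit assms(1)] .
  then have "\<forall>\<^sub>F k in sequentially. \<mu> k x \<ge> m"
  proof (rule eventually_mono)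
    fix k assume "u k x > 0"
    then show "\<mu> k x \<ge> m" using mass_ge_threshold[of k x] odometer_le_limit[of k x] assms by linarith
  qed
  then show ?thesis using tendsto_lowerbound[OF mass_limit] by simp
qed

lemma boundary_limit:
  assumes "x \<in> lattice_boundary (V n m T)"
  shows "v x = 0" and "x = 0 \<or> (\<exists>p. len (p - x) = 1 \<and> v p > 0)"
proof -
  obtain y where y: "y \<sim> x" "y \<notin> V n m T" and x: "x \<in> V n m T"
    using assms by (auto simp: lattice_boundary_def)
  have "u k x = 0" for k
  proof (rule ccontr)
    assume "u k x \<noteq> 0"
    then have "u k x > 0" using odometer_nonneg[of k x] by linarith
    then have "y \<in> visited (S k)" using y(1) adj_sym[of y x] by (auto simp: visited_eq)
    then show False using y(2) by (auto simp: V_def)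
  qed
  then show "v x = 0" using odometer_limit[of x] LIMSEQ_unique[OF _ tendsto_const] by simp
  obtain k where "x \<in> visited (S k)" using x by (auto simp: V_def)
  then consider "x = 0" | p where "u k p > 0" "p \<sim> x" by (auto simp: visited_eq)
  then show "x = 0 \<or> (\<exists>p. len (p - x) = 1 \<and> v p > 0)"
  proof cases
    case 2
    then have "v p > 0" using odometer_le_limit[of k p] by linarith
    moreover have "len (p - x) = 1" using adj_len[of x p] adj_sym[of x p] 2 by blast
    ultimately show ?thesis by blast
  qed simp
qed

end

section \<open>Bounds on the radius\<close>

context sandpile_run
begin

lemma K_eq: "K = (n powr (1 / real CARD('d)))\<^sup>2 / m"
  using n_pos by (simp add: K_def odometer_bound_def powr_powr flip: powr_numeral)

text \<open>Maximum principle: \<open>v\<close> has finite support and is subharmonic off the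
  source. Among the maximisers one is taken extremal in a coordinate; unless it is the origin, the
  next site in that direction would be a maximiser too. Consequently the source lies in no region
  where \<open>v \<le> K\<close>.\<close>

lemma origin_exceeds:
  assumes "v z > K"
  shows "v 0 > K"
proof -
  define F where "F = {x. v x \<noteq> 0}"
  have F: "finite F" "z \<in> F" using finite_limit_support assms K_pos by (auto simp: F_def)
  define M where "M = Max (v ` F)"
  have M: "v x \<le> M" if "x \<in> F" for x using F that by (simp add: M_def)
  have "M > K" using M[OF F(2)] assms by linarith
  then have le_M: "v x \<le> M" for x using M[of x] K_pos by (cases "x \<in> F") (auto simp: F_def)
  obtain i :: 'd where True by blast
  define P where "P = {x. v x = M}"
  have "P \<subseteq> F" using \<open>M > K\<close> K_pos by (auto simp: P_def F_def)
  then have "finite P" using F finite_subset by blast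
  moreover have "P \<noteq> {}"
  proof -
    have "M \<in> v ` F" unfolding M_def using F by (intro Max_in) auto
    then show ?thesis by (auto simp: P_def)
  qed
  ultimately have "Max ((\<lambda>y. y $ i) ` P) \<in> (\<lambda>y. y $ i) ` P" by (intro Max_in) auto
  then obtain y where y: "y \<in> P" "y $ i = Max ((\<lambda>y. y $ i) ` P)" by auto
  have "y = 0"
  proof (rule ccontr)
    assume "y \<noteq> 0"
    let ?w = "\<lambda>x. M - v x"
    have "lap ?w y \<ge> ?w (y + axis i 1) / (2 * real CARD('d)) - ?w y"
      by (rule lap_ge_single[where j = i]) (auto simp: le_M)
    moreover have "lap ?w y \<le> 0"
      using limit_mass_nonneg[of y] \<open>y \<noteq> 0\<close> by (simp add: lap_diff lap_const)
    moreover have "?w y = 0" using y by (simp add: P_def)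
    ultimately have "?w (y + axis i 1) / (2 * real CARD('d)) \<le> 0" by linarith
    then have "v (y + axis i 1) = M" using le_M[of "y + axis i 1"] by (simp add: divide_le_0_iff)
    then have "y + axis i 1 \<in> P" by (simp add: P_def)
    then have "(y + axis i 1) $ i \<le> Max ((\<lambda>y. y $ i) ` P)"
      using \<open>finite P\<close> by (intro Max_ge finite_imageI imageI)
    then show False using y by (simp add: axis_def)
  qed
  then show ?thesis using y \<open>M > K\<close> by (simp add: P_def)
qed

text \<open>Nondegeneracy: near a site where \<open>v > 0\<close>, the function \<open>v - m / 2 |\<cdot> - p|\<^sup>2\<close> is strictly subharmonic
  wherever \<open>0 < v \<le> K\<close>, so that \<open>v\<close> grows quadratically.\<close>

lemma radius_upper:
  assumes x0: "x0 \<in> lattice_boundary (V n m T)" and r: "r > 2"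
    and empty: "\<And>x. len (x - x0) < r \<Longrightarrow> v x \<le> K" and z: "v z > K"
  shows "m / 2 * (r - 2)\<^sup>2 \<le> K"
proof -
  have v0: "v 0 > K" using z by (rule origin_exceeds)
  have "x0 \<noteq> 0" using boundary_limit(1)[OF x0] v0 K_pos by auto
  then obtain p where p: "len (p - x0) = 1" "v p > 0" using boundary_limit(2)[OF x0] by blast
  \<comment> \<open>The \<open>2\<close> accounts for one step from \<open>x0\<close> to
    \<open>p\<close> and one from the maximiser to its neighbour, so that \<open>v \<le> K\<close>
    is known at both.\<close>
  define D where "D = {x. len (x - p) < r - 2 \<and> v x > 0}"
  have D: "finite D" "p \<in> D"
    using finite_subset[OF _ finite_len_less[of p "r - 2"], of D] r p by (auto simp: D_def len_0)
  define w where "w = (\<lambda>x. v x - m / 2 * sqn (x - p))"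
  have "Max (w ` D) \<in> w ` D" using D by (intro Max_in) auto
  then obtain y where y: "y \<in> D" "w y = Max (w ` D)" by auto
  have wmax: "w x \<le> w y" if "x \<in> D" for x using D that y by simp
  have wy: "w y > 0" using wmax[OF D(2)] p by (simp add: w_def sqn_def)
  have yp: "len (y - p) < r - 2" "v y > 0" using y by (auto simp: D_def)
  have "len (y - x0) < r" using len_diff_triangle[of y x0 p] yp p by simp
  then have yK: "v y \<le> K" by (rule empty)
  then have "y \<noteq> 0" using v0 by auto
  then have "lap v y \<ge> m" using limit_mass_ge[OF yp(2) yK] by simp
  moreover have "lap w y = lap v y - m / 2"
    unfolding w_def lap_diff lap_cmult using lap_shift[of sqn p y] by (simp add: lap_sqn)
  ultimately have "lap w y > 0" using m_pos by simp
  then obtain i y' where y': "y' = y + axis i 1 \<or> y' = y - axis i 1" "w y' > w y"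
    using ex_larger_neighbour by blast
  have yy': "len (y' - y) = 1" using y'(1) adj_iff[of y y'] adj_len by blast
  \<comment> \<open>Positivity of \<open>w y'\<close> forces \<open>v y' > 0\<close>, so
    \<open>y'\<close> can have left \<open>D\<close> only by leaving the ball.\<close>
  have big: "v y' > m / 2 * sqn (y' - p)" using y'(2) wy by (simp add: w_def)
  moreover have "m / 2 * sqn (y' - p) \<ge> 0" using m_pos sqn_nonneg[of "y' - p"] by simp
  ultimately have "v y' > 0" by linarith
  moreover have "y' \<notin> D" using wmax[of y'] y'(2) by auto
  ultimately have far: "len (y' - p) \<ge> r - 2" by (auto simp: D_def)
  have "len (y' - x0) < r"
    using len_diff_triangle[of y' x0 y] len_diff_triangle[of y x0 p] yp p yy' by simp
  then have "v y' \<le> K" by (rule empty)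
  moreover have "(r - 2)\<^sup>2 \<le> sqn (y' - p)" unfolding len_sq[symmetric] using far r by (intro power_mono) auto
  then have "m / 2 * (r - 2)\<^sup>2 \<le> m / 2 * sqn (y' - p)" using m_pos by (intro mult_left_mono) auto
  ultimately show ?thesis using big by linarith
qed

end

text \<open>Adding \<open>m * (R^2 - |x - x0|^2)\<close> makes \<open>v\<close> superharmonic, since
  the limit mass is at most \<open>m\<close>, while the value at \<open>x0\<close> is just
  \<open>m * R^2\<close>. If the source is near, the pointwise clause of the Harnack inequality
  bounds \<open>n\<close> itself; otherwise the sum clause and subharmonicity around
  \<open>z\<close> bound \<open>v z\<close>.\<close>

lemma radius_lower:
  assumes "CARD('d::finite) \<ge> 2"
  obtains C :: real where "C > 0"
    "\<And>n m K \<theta> (T :: nat \<Rightarrow> int ^ 'd) x0 z \<rho>. sandpile_run n m K \<theta> T \<Longrightarrow> m \<ge> 1 \<Longrightarrow>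
      limit_odometer n m T x0 = 0 \<Longrightarrow> limit_odometer n m T z > K \<Longrightarrow> \<rho> \<ge> 1 \<Longrightarrow> len (z - x0) < \<rho> \<Longrightarrow>
      n powr (1 / real CARD('d)) \<le> C * (m * \<rho>)"
proof -
  let ?d = "CARD('d)"
  obtain B W :: real where B: "B \<ge> 1" "W > 0" and harnack:
    "\<And>\<sigma> y (w :: int ^ 'd \<Rightarrow> real).
      \<sigma> \<ge> 1 \<Longrightarrow> (\<And>x. len (x - y) \<le> B * \<sigma> + 1 \<Longrightarrow> w x \<ge> 0) \<Longrightarrow>
      (\<And>x. len (x - y) < B * \<sigma> \<Longrightarrow> lap w x \<le> 0) \<Longrightarrow>
      (\<Sum>x | len (x - y) \<le> \<sigma>. w x) \<le> W * \<sigma> ^ ?d * w y \<and>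
      (\<forall>z. len (z - y) \<le> \<sigma> \<longrightarrow> - lap w z * \<sigma>\<^sup>2 \<le> W * \<sigma> ^ ?d * w y)"
    by (rule weak_harnack[OF assms]) blast
  obtain Q :: real where Q: "Q > 0" and mean:
    "\<And>\<rho> z (u :: int ^ 'd \<Rightarrow> real). \<rho> > 0 \<Longrightarrow> (\<And>x. u x \<ge> 0) \<Longrightarrow>
      (\<And>x. len (x - z) < \<rho> \<Longrightarrow> lap u x \<ge> 0) \<Longrightarrow>
      \<rho> ^ ?d * u z \<le> Q * (\<Sum>x | len (x - z) < \<rho>. u x)"
    by (rule sub_mean_value[OF assms]) blast
  define W' where "W' = W * (B + 1)\<^sup>2"
  have W': "W' > 0" using B by (simp add: W'_def)
  define C1 C2 where "C1 = max 1 W'" and "C2 = Q * W' * 2 ^ (?d + 2)"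
  have C1: "C1 \<ge> 1" "W' \<le> C1" and C2: "C2 > 0" using Q W' by (auto simp: C1_def C2_def)
  define C where "C = 2 * C1 + sqrt C2"
  have C: "C > 0" "2 * C1 \<le> C" "sqrt C2 \<le> C" using C1 C2 by (auto simp: C_def add_pos_nonneg)
  have "n powr (1 / real ?d) \<le> C * (m * \<rho>)"
    if run: "sandpile_run n m K \<theta> T" and m: "m \<ge> 1" and x0: "limit_odometer n m T x0 = 0"
      and z: "limit_odometer n m T z > K" and \<rho>: "\<rho> \<ge> 1" "len (z - x0) < \<rho>"
    for n m K \<theta> and T :: "nat \<Rightarrow> int ^ 'd" and x0 z \<rho>
  proof -
    interpret sandpile_run n m K \<theta> T by (rule run)
    \<comment> \<open>The factor \<open>2\<close> puts the ball of radius \<rho> around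
      \<open>z\<close> inside the ball of radius \<sigma> around \<open>x0\<close>.\<close>
    define \<sigma> R where "\<sigma> = 2 * \<rho>" and "R = B * \<sigma> + 1"
    have \<sigma>: "\<sigma> \<ge> 1" using \<rho> by (simp add: \<sigma>_def)
    have "1 * \<sigma> \<le> B * \<sigma>" using B \<sigma> by (intro mult_right_mono) auto
    then have R: "R \<ge> \<sigma>" "R \<ge> 0" using \<sigma> unfolding R_def by linarith+
    have "R \<le> (B + 1) * \<sigma>" using \<sigma> by (simp add: R_def algebra_simps)
    then have "R\<^sup>2 \<le> ((B + 1) * \<sigma>)\<^sup>2" using R by (intro power_mono) auto
    then have R2: "R\<^sup>2 \<le> (B + 1)\<^sup>2 * \<sigma>\<^sup>2" by (simp add: power_mult_distrib)
    define w where "w = (\<lambda>x. v x + m * (R\<^sup>2 - sqn (x - x0)))"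
    have lap_w: "lap w x = lap v x - m" for x
    proof -
      have "lap (\<lambda>x. sqn (x - x0)) x = 1" using lap_shift[of sqn x0 x] by (simp add: lap_sqn)
      then show ?thesis unfolding w_def lap_add lap_cmult lap_diff lap_const by simp
    qed
    have w_ge: "w x \<ge> v x" if "len (x - x0) \<le> R" for x
    proof -
      have "sqn (x - x0) \<le> R\<^sup>2" unfolding len_sq[symmetric] using that len_nonneg by (intro power_mono) auto
      then show ?thesis using m by (simp add: w_def)
    qed
    have w_nonneg: "w x \<ge> 0" if "len (x - x0) \<le> B * \<sigma> + 1" for x
      using w_ge[of x] that limit_nonneg[of x] by (simp add: R_def)
    have w_super: "lap w x \<le> 0" for x
      using limit_mass_le[of x] n_pos by (auto simp: lap_w split: if_splits)
    have bound: "W * \<sigma> ^ ?d * w x0 \<le> W' * m * \<sigma> ^ ?d * \<sigma>\<^sup>2"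
    proof -
      have "w x0 = m * R\<^sup>2" using x0 by (simp add: w_def sqn_def)
      then have "W * \<sigma> ^ ?d * w x0 = W * m * \<sigma> ^ ?d * R\<^sup>2" by simp
      also have "\<dots> \<le> W * m * \<sigma> ^ ?d * ((B + 1)\<^sup>2 * \<sigma>\<^sup>2)"
        using R2 B m \<sigma> by (intro mult_left_mono) auto
      finally show ?thesis by (simp add: W'_def mult_ac)
    qed
    note H = harnack[of \<sigma> x0 w, OF \<sigma> w_nonneg w_super]
    show ?thesis
    proof (cases "len (0 - x0) \<le> \<sigma>")
      case True
      have "n \<le> - lap w 0" using limit_mass_le[of 0] by (simp add: lap_w)
      then have "n * \<sigma>\<^sup>2 \<le> - lap w 0 * \<sigma>\<^sup>2" by (intro mult_right_mono) auto
      also have "\<dots> \<le> W * \<sigma> ^ ?d * w x0" using H True by blast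
      also note bound
      finally have "n \<le> W' * m * \<sigma> ^ ?d" using \<sigma> by simp
      \<comment> \<open>\<open>m \<ge> 1\<close> allows a perfect d-th power, whose root is linear
        in \<open>m * \<rho>\<close>.\<close>
      also have "\<dots> \<le> C1 ^ ?d * m ^ ?d * \<sigma> ^ ?d"
      proof (intro mult_right_mono mult_mono)
        show "W' \<le> C1 ^ ?d" using C1 self_le_power[of C1 ?d] by simp
        show "m \<le> m ^ ?d" using m self_le_power[of m ?d] by simp
      qed (use m \<sigma> C1 in auto)
      also have "\<dots> = (C1 * m * \<sigma>) ^ ?d" by (simp add: power_mult_distrib)
      finally have "n powr (1 / real ?d) \<le> ((C1 * m * \<sigma>) ^ ?d) powr (1 / real ?d)"
        using n_pos by (intro powr_mono2) auto
      also have "\<dots> = C1 * m * \<sigma>"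
        using C1 m \<sigma> by (simp add: powr_powr flip: powr_realpow)
      also have "\<dots> = 2 * C1 * (m * \<rho>)" by (simp add: \<sigma>_def)
      also have "\<dots> \<le> C * (m * \<rho>)" using C m \<rho> by (intro mult_right_mono) auto
      finally show ?thesis .
    next
      case False
      have near: "len (x - x0) < \<sigma>" if "len (x - z) < \<rho>" for x
        using len_diff_triangle[of x x0 z] that \<rho> by (simp add: \<sigma>_def)
      have "\<rho> ^ ?d * v z \<le> Q * (\<Sum>x | len (x - z) < \<rho>. v x)"
      proof (rule mean)
        fix x assume "len (x - z) < \<rho>"
        then have "x \<noteq> 0" using near[of x] False by auto
        then show "lap v x \<ge> 0" using limit_mass_nonneg[of x] by simp
      qed (use \<rho> limit_nonneg in auto)
      also have "(\<Sum>x | len (x - z) < \<rho>. v x) \<le> (\<Sum>x | len (x - x0) \<le> \<sigma>. v x)"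
        using near limit_nonneg finite_len_le by (intro sum_mono2) (auto simp: less_imp_le)
      also have "\<dots> \<le> (\<Sum>x | len (x - x0) \<le> \<sigma>. w x)"
        using w_ge R by (intro sum_mono) auto
      also have "\<dots> \<le> W * \<sigma> ^ ?d * w x0" using H by blast
      also note bound
      finally have "\<rho> ^ ?d * v z \<le> Q * (W' * m * \<sigma> ^ ?d * \<sigma>\<^sup>2)" using Q by simp
      also have "\<dots> = \<rho> ^ ?d * (C2 * m * \<rho>\<^sup>2)"
        by (simp add: \<sigma>_def C2_def power_mult_distrib)
      finally have "v z \<le> C2 * m * \<rho>\<^sup>2" using \<rho> by simp
      with z have "K \<le> C2 * m * \<rho>\<^sup>2" by linarith
      then have "(n powr (1 / real ?d))\<^sup>2 \<le> C2 * m * \<rho>\<^sup>2 * m"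
        using m_pos by (simp add: K_eq pos_divide_le_eq)
      also have "\<dots> = (sqrt C2 * (m * \<rho>))\<^sup>2"
        using C2 by (simp add: power_mult_distrib power2_eq_square[of m])
      finally have "n powr (1 / real ?d) \<le> sqrt C2 * (m * \<rho>)"
        by (rule power2_le_imp_le) (use C2 m \<rho> in simp)
      also have "\<dots> \<le> C * (m * \<rho>)" using C m \<rho> by (intro mult_right_mono) auto
      finally show ?thesis .
    qed
  qed
  then show ?thesis using that[of C] C by blast
qed

theorem lemma3p6:
  assumes "CARD('d::finite) \<ge> 2"
  shows "\<exists>c C :: real. 0 < c \<and> c < C \<and>
    (\<forall>m :: real. m > 1 \<longrightarrow>
      (\<exists>N :: real. \<forall>n :: real. n \<ge> N \<longrightarrow>
        (\<forall>T :: nat \<Rightarrow> int ^ 'd. infinitive T \<longrightarrow>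
          (\<forall>x\<^sub>0 \<in> lattice_boundary (V n m T). \<forall>r :: real.
            r > 0 \<and> lattice_ball x\<^sub>0 r \<inter> V0 n m T = {} \<and> lattice_ball x\<^sub>0 (r + 1) \<inter> V0 n m T \<noteq> {} \<longrightarrow>
              c * (n powr (1 / real CARD('d)) / m) \<le> r \<and>
              r \<le> C * (n powr (1 / real CARD('d)) / m)))))"
proof -
  let ?d = "CARD('d)"
  obtain L :: real where L: "L > 0" and lower:
    "\<And>n m K \<theta> (T :: nat \<Rightarrow> int ^ 'd) x0 z \<rho>. sandpile_run n m K \<theta> T \<Longrightarrow> m \<ge> 1 \<Longrightarrow>
      limit_odometer n m T x0 = 0 \<Longrightarrow> limit_odometer n m T z > K \<Longrightarrow> \<rho> \<ge> 1 \<Longrightarrow> len (z - x0) < \<rho> \<Longrightarrow>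
      n powr (1 / real ?d) \<le> L * (m * \<rho>)"
    by (rule radius_lower[OF assms]) blast
  \<comment> \<open>From \<open>s / L \<le> r + 1\<close>, half of \<open>s / L\<close> is given up
    to cancel the \<open>1\<close>.\<close>
  define c where "c = 1 / (2 * L)"
  have c: "c > 0" using L by (simp add: c_def)
  \<comment> \<open>The bound on \<open>n\<close> says \<open>s \<ge> 2 * L + 1\<close>: at least
    \<open>2 * L\<close> for the lower estimate, at least \<open>1\<close> to turn
    \<open>r \<le> 2 + 2 * s\<close> into \<open>r \<le> 4 * s\<close>.\<close>
  have bounds: "c * (n powr (1 / real ?d) / m) \<le> r \<and> r \<le> (4 + c) * (n powr (1 / real ?d) / m)"
    if m: "m > 1" and n: "n \<ge> (m * (2 * L + 1)) powr real ?d" and T: "infinitive T"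
      and x0: "x0 \<in> lattice_boundary (V n m T)" and r: "r > 0" "lattice_ball x0 r \<inter> V0 n m T = {}"
        "lattice_ball x0 (r + 1) \<inter> V0 n m T \<noteq> {}"
    for m n r :: real and T :: "nat \<Rightarrow> int ^ 'd" and x0
  proof -
    define K where "K = odometer_bound TYPE('d) n m"
    have pos: "m * (2 * L + 1) > 0" using m L by (simp add: add_pos_pos)
    then have "(m * (2 * L + 1)) powr real ?d > 0"
      using less_imp_neq[OF pos, symmetric] by (simp only: powr_gt_zero not_False_eq_True)
    then have n_pos: "n > 0" using n by linarith
    have run: "sandpile_run n m K (min m (K / (2 * real ?d))) T"
      using m n_pos T assms by unfold_locales (auto simp: K_def)
    interpret sandpile_run n m K "min m (K / (2 * real ?d))" T by (rule run)
    define s where "s = n powr (1 / real ?d) / m"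
    have "((m * (2 * L + 1)) powr real ?d) powr (1 / real ?d) \<le> n powr (1 / real ?d)"
      using n by (intro powr_mono2) auto
    moreover have "real ?d * (1 / real ?d) = 1" by simp
    ultimately have "m * (2 * L + 1) \<le> n powr (1 / real ?d)"
      using powr_one[OF less_imp_le[OF pos]] by (simp only: powr_powr)
    then have s: "2 * L + 1 \<le> s" using m by (simp add: s_def pos_le_divide_eq mult.commute)
    have V0: "x \<in> V0 n m T \<longleftrightarrow> v x > K" for x by (simp add: V0_def K_def)
    obtain z where z: "len (z - x0) < r + 1" "v z > K"
      using r(3) by (auto simp: V0 mem_lattice_ball)
    have empty: "v x \<le> K" if "len (x - x0) < r" for x
      using r(2) that V0[of x] by (force simp: mem_lattice_ball)
    have "n powr (1 / real ?d) \<le> L * (m * (r + 1))"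
      using m r z by (intro lower[OF run _ boundary_limit(1)[OF x0]]) auto
    then have "s \<le> L * (r + 1)" using m by (simp add: s_def pos_divide_le_eq mult_ac)
    then have "s / L \<le> r + 1" using L by (simp add: field_simps)
    moreover have "1 \<le> s / (2 * L)" using s L by simp
    ultimately have "c * s \<le> r" by (simp add: c_def)
    moreover have "r \<le> 4 * s"
    proof (cases "r > 2")
      case True
      have "m / 2 * (r - 2)\<^sup>2 \<le> K" by (rule radius_upper[OF x0 True empty z(2)])
      also have "K = m * s\<^sup>2" using m by (simp add: K_eq s_def power2_eq_square)
      finally have "(r - 2)\<^sup>2 \<le> 2 * s\<^sup>2" using m by simp
      also have "\<dots> \<le> (2 * s)\<^sup>2" by simp
      finally have "r - 2 \<le> 2 * s" by (rule power2_le_imp_le) (use s L in simp)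
      then show ?thesis using s L by linarith
    next
      case False
      then show ?thesis using s L by linarith
    qed
    moreover have "0 \<le> c * s" using c s L by simp
    ultimately show ?thesis by (simp add: s_def[symmetric] distrib_right)
  qed
  show ?thesis
  \<comment> \<open>The upper constant \<open>4\<close> is enlarged by \<open>c\<close> to ensure
    that it exceeds the lower one.\<close>
  proof (rule exI[of _ c], rule exI[of _ "4 + c"], intro conjI allI impI)
    fix m :: real assume m: "m > 1"
    show "\<exists>N :: real. \<forall>n :: real. n \<ge> N \<longrightarrow>
        (\<forall>T :: nat \<Rightarrow> int ^ 'd. infinitive T \<longrightarrow>
          (\<forall>x\<^sub>0 \<in> lattice_boundary (V n m T). \<forall>r :: real.
            r > 0 \<and> lattice_ball x\<^sub>0 r \<inter> V0 n m T = {} \<and> lattice_ball x\<^sub>0 (r + 1) \<inter> V0 n m T \<noteq> {} \<longrightarrow>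
              c * (n powr (1 / real ?d) / m) \<le> r \<and> r \<le> (4 + c) * (n powr (1 / real ?d) / m)))"
      using bounds[OF m] by (intro exI[of _ "(m * (2 * L + 1)) powr real ?d"] allI impI ballI) blast
  qed (use c in auto)
qed

end
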